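(* Let $(G,c)$ be a resistance network with fixed vertex $o$, energy space $\mathcal{H}_{\mathcal{E}}$, harmonic subspace $\mathrm{Harm}$, Gel'fand triple $\mathcal{S}\subseteq\mathcal{H}_{\mathcal{E}}\subseteq\mathcal{S}'$ and probability measure $\mathbb{P}$ on $\mathcal{S}'$ as defined in the context. For any $u\in\mathrm{Harm}$, and with $h_x:=P_{\mathrm{Harm}}v_x$, $$u(x)=\int_{\mathcal{S}'}u(\xi)\,h_x(\xi)\,d\mathbb{P}(\xi)+u(o)\qquad\text{for all }x\in G,$$ where, for $w\in\mathcal{H}_{\mathcal{E}}$ and $\xi\in\mathcal{S}'$, $w(\xi):=\langle w,\xi\rangle_{\mathcal{W}}$.
   Context: A resistance network $(G,c)$ is a connected graph with vertex set $G^{0}$ (one writes $x\in G$ for $x\in G^{0}$) together with a symmetric conductance function $c_{xy}=c_{yx}\in[0,\infty)$; adjacency $x\sim y$ means $c_{xy}>0$; $c_{xx}=0$; and $c(x):=\sum_{y\sim x}c_{xy}<\infty$ for each $x$. A vertex $o$ is fixed. Laplacian: $(\Delta v)(x):=\sum_{y\sim x}c_{xy}(v(x)-v(y))$. Energy: $\mathcal{E}(u,v):=\frac12\sum_{x,y\in G}c_{xy}(\overline{u(x)}-\overline{u(y)})(v(x)-v(y))$, $\mathcal{E}(u):=\mathcal{E}(u,u)$, $\operatorname{dom}\mathcal{E}:=\{u:G^{0}\to\mathbb{C}:\mathcal{E}(u)<\infty\}$. The energy space is the Hilbert space $\mathcal{H}_{\mathcal{E}}:=\operatorname{dom}\mathcal{E}/\mathbb{C}\mathbf{1}$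 with inner product $\langle u,v\rangle_{\mathcal{E}}:=\mathcal{E}(u,v)$. The values $u(x),u(o)$ are those of any representative of $u$. $\mathrm{Harm}:=\{v\in\mathcal{H}_{\mathcal{E}}:\Delta v(x)=0\text{ for all }x\in G\}$, and $P_{\mathrm{Harm}}$ is the orthogonal projection onto it. Energy kernel: $v_x\in\mathcal{H}_{\mathcal{E}}$ is the unique element with $\langle v_x,u\rangle_{\mathcal{E}}=u(x)-u(o)$ for all $u\in\mathcal{H}_{\mathcal{E}}$. $\mathrm{Fin}$ is the $\mathcal{E}$-closure of the span of the Dirac masses, and $f_x$ is the orthogonal projection of $v_x$ to $\mathrm{Fin}$. A monopole at $x$ is $w_x\in\mathcal{H}_{\mathcal{E}}$ with $\Delta w_x=\delta_x$ pointwise. If monopoles exist, $w_o$ is the energy-minimizing monopole at $o$, $w_x^v:=v_x+w_o$, $w_x^f:=f_x+w_o$. Let $\mathcal{M}:=\operatorname{span}\{v_x\}+\operatorname{span}\{w_x^v,w_x^f\}$ (just $\operatorname{span}\{v_x\}$ if there are no monopoles), and let $\Delta_{\mathcal{M}}$ be the closure in $\mathcal{H}_{\mathcal{E}}$ of $\Delta$ with dense domain $\mathcal{M}$; it is Hermitian and commutes with complex conjugation, so has self-adjoint extensions. Let $\Delta_{\mathcal{S}}$ be a self-adjoint extension of $\Delta_{\mathcal{M}}$. Test functions and distributions: $\mathcal{S}:=\bigcap_{p=1}^\infty\operatorname{dom}(\Delta_{\mathcal{S}}^p)$, with the Fréchet topology given by the seminorms $\|u\|_p:=\|\Delta_{\mathcal{S}}^pu\|_{\mathcal{E}}$,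 $p\in\mathbb{N}$; $\mathcal{S}'$ is the space of linear functionals on $\mathcal{S}$ continuous for this topology. Here $\mathcal{S}$ and $\mathcal{S}'$ consist of $\mathbb{R}$-valued objects. $\mathcal{S}\subseteq\mathcal{H}_{\mathcal{E}}\subseteq\mathcal{S}'$ is regarded as a Gel'fand triple ($\mathcal{S}$ dense in $\mathcal{H}_{\mathcal{E}}$ and continuously included in it). Pairing: for $u\in\mathcal{S}$ and $\xi\in\mathcal{S}'$, $\langle u,\xi\rangle_{\mathcal{W}}:=\langle\Delta_{\mathcal{S}}^pu,\Delta_{\mathcal{S}}^{-p}\xi\rangle_{\mathcal{E}}$ for any integer $p$ such that $|\xi(u)|\le K\|\Delta_{\mathcal{S}}^pu\|_{\mathcal{E}}$ for all $u\in\mathcal{S}$; equivalently $\langle u,\xi\rangle_{\mathcal{W}}=\lim_{n\to\infty}\xi(E_nu)$, where $E_n$ is the spectral projection of $\Delta_{\mathcal{S}}$ for the interval $[\frac1n,n]$ (which maps $\mathcal{H}_{\mathcal{E}}$ into $\mathcal{S}$). It is extended to $u\in\mathcal{H}_{\mathcal{E}}$ by $\langle u,\xi\rangle_{\mathcal{W}}=\lim_{n\to\infty}\langle u,\tilde E_n\xi\rangle_{\mathcal{E}}$, where $\tilde E_n\xi\in\mathcal{H}_{\mathcal{E}}$ is defined by $\langle u,\tilde E_n\xi\rangle_{\mathcal{E}}:=\xi(E_nu)$. For complex-valued $u=u_1+\mathrm{i}u_2$ with $u_1,u_2$ real-valued, $u(\xi)=u_1(\xi)+\mathrm{i}u_2(\xi)$.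 Measure: $\mathbb{P}$ is the Radon probability measure on $\mathcal{S}'$ corresponding, by Minlos' theorem applied to the Gel'fand triple $\mathcal{S}\subseteq\mathcal{H}_{\mathcal{E}}\subseteq\mathcal{S}'$, to the positive definite function $s\mapsto e^{-\frac12\|s\|_{\mathcal{E}}^2}$, i.e. $\int_{\mathcal{S}'}e^{\mathrm{i}\langle s,\xi\rangle_{\mathcal{W}}}\,d\mathbb{P}(\xi)=e^{-\frac12\|s\|_{\mathcal{E}}^2}$ for all $s\in\mathcal{S}$.
   Formalization: For u in S the pairing is taken to be ξ(u), with the energy norm (p=0) among the seminorms; the stated limit formula over spectral projections for [1/n,n] gives 0 on nonzero harmonic functions (which lie in the kernel of Δ_S), contradicting the Minlos identity. *)

theory Defs
  imports "HOL-Probability.Probability"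
begin

section \<open>Functions modulo constants\<close>

text \<open>The vertex set is the whole type \<open>'v\<close>.  An element of \<open>'v potential\<close> is a class of functions
  \<open>'v \<Rightarrow> complex\<close> modulo constants; the energy space is a subset of this type.\<close>

quotient_type 'v potential = "'v \<Rightarrow> complex" / "\<lambda>u v. \<exists>k. \<forall>x. u x = v x + k"
proof (rule equivpI)
  show "reflp (\<lambda>u v :: 'v \<Rightarrow> complex. \<exists>k. \<forall>x. u x = v x + k)"
    by (rule reflpI) (rule exI[of _ 0], simp)
  show "symp (\<lambda>u v :: 'v \<Rightarrow> complex. \<exists>k. \<forall>x. u x = v x + k)"
  proof (rule sympI)
    fix u v :: "'v \<Rightarrow> complex"
    assume "\<exists>k. \<forall>x. u x = v x + k"
    then obtain k where "\<forall>x. u x = v x + k" by blast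
    then show "\<exists>k. \<forall>x. v x = u x + k" by (intro exI[of _ "- k"]) simp
  qed
  show "transp (\<lambda>u v :: 'v \<Rightarrow> complex. \<exists>k. \<forall>x. u x = v x + k)"
  proof (rule transpI)
    fix u v w :: "'v \<Rightarrow> complex"
    assume "\<exists>k. \<forall>x. u x = v x + k" "\<exists>k. \<forall>x. v x = w x + k"
    then obtain k l where "\<forall>x. u x = v x + k" "\<forall>x. v x = w x + l" by blast
    then show "\<exists>k. \<forall>x. u x = w x + k" by (intro exI[of _ "k + l"]) simp
  qed
qed

instantiation potential :: (type) ab_group_add
begin

lift_definition zero_potential :: "'a potential" is "\<lambda>_. 0" .

lift_definition plus_potential :: "'a potential \<Rightarrow> 'a potential \<Rightarrow> 'a potential"
  is "\<lambda>u v x. u x + v x"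
proof -
  fix u u' v v' :: "'a \<Rightarrow> complex"
  assume "\<exists>k. \<forall>x. u x = u' x + k" "\<exists>k. \<forall>x. v x = v' x + k"
  then obtain k l where "\<forall>x. u x = u' x + k" "\<forall>x. v x = v' x + l" by blast
  then show "\<exists>k. \<forall>x. u x + v x = u' x + v' x + k" by (intro exI[of _ "k + l"]) simp
qed

lift_definition uminus_potential :: "'a potential \<Rightarrow> 'a potential" is "\<lambda>u x. - u x"
proof -
  fix u u' :: "'a \<Rightarrow> complex"
  assume "\<exists>k. \<forall>x. u x = u' x + k"
  then obtain k where "\<forall>x. u x = u' x + k" by blast
  then show "\<exists>k. \<forall>x. - u x = - u' x + k" by (intro exI[of _ "- k"]) simp
qed

definition minus_potential :: "'a potential \<Rightarrow> 'a potential \<Rightarrow> 'a potential"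
  where "minus_potential U V = U + - V"

instance
proof
  fix a b c :: "'a potential"
  show "a + b + c = a + (b + c)" by transfer (rule exI[of _ 0], simp)
  show "a + b = b + a" by transfer (rule exI[of _ 0], simp)
  show "0 + a = a" by transfer (rule exI[of _ 0], simp)
  show "- a + a = 0" by transfer (rule exI[of _ 0], simp)
  show "a - b = a + - b" by (rule minus_potential_def)
qed

end

lift_definition cscale :: "complex \<Rightarrow> 'v potential \<Rightarrow> 'v potential" is "\<lambda>a u x. a * u x"
proof -
  fix a and u u' :: "'v \<Rightarrow> complex"
  assume "\<exists>k. \<forall>x. u x = u' x + k"
  then obtain k where "\<forall>x. u x = u' x + k" by blast
  then show "\<exists>k. \<forall>x. a * u x = a * u' x + k"
    by (intro exI[of _ "a * k"]) (simp add: algebra_simps)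
qed

interpretation potential: vector_space "cscale :: complex \<Rightarrow> 'v potential \<Rightarrow> 'v potential"
proof
  fix a b :: complex and U V :: "'v potential"
  show "cscale a (U + V) = cscale a U + cscale a V"
    by transfer (rule exI[of _ 0], simp add: algebra_simps)
  show "cscale (a + b) U = cscale a U + cscale b U"
    by transfer (rule exI[of _ 0], simp add: algebra_simps)
  show "cscale a (cscale b U) = cscale (a * b) U" by transfer (rule exI[of _ 0], simp)
  show "cscale 1 U = U" by transfer (rule exI[of _ 0], simp)
qed

lift_definition potential_of :: "('v \<Rightarrow> complex) \<Rightarrow> 'v potential" is "\<lambda>u. u" .

lift_definition pdiff :: "'v potential \<Rightarrow> 'v \<Rightarrow> 'v \<Rightarrow> complex" is "\<lambda>u x y. u x - u y"
  by (rule ext)+ auto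

lift_definition pRe :: "'v potential \<Rightarrow> 'v potential" is "\<lambda>u x. complex_of_real (Re (u x))"
proof -
  fix u u' :: "'v \<Rightarrow> complex"
  assume "\<exists>k. \<forall>x. u x = u' x + k"
  then obtain k where "\<forall>x. u x = u' x + k" by blast
  then show "\<exists>k. \<forall>x. complex_of_real (Re (u x)) = complex_of_real (Re (u' x)) + k"
    by (intro exI[of _ "complex_of_real (Re k)"]) simp
qed

lift_definition pIm :: "'v potential \<Rightarrow> 'v potential" is "\<lambda>u x. complex_of_real (Im (u x))"
proof -
  fix u u' :: "'v \<Rightarrow> complex"
  assume "\<exists>k. \<forall>x. u x = u' x + k"
  then obtain k where "\<forall>x. u x = u' x + k" by blast
  then show "\<exists>k. \<forall>x. complex_of_real (Im (u x)) = complex_of_real (Im (u' x)) + k"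
    by (intro exI[of _ "complex_of_real (Im k)"]) simp
qed

definition real_valued :: "'v potential \<Rightarrow> bool"
  where "real_valued U \<longleftrightarrow> (\<exists>u :: 'v \<Rightarrow> real. U = potential_of (\<lambda>x. complex_of_real (u x)))"


section \<open>Resistance networks and the energy space\<close>

locale resistance_network =
  fixes c :: "'v \<Rightarrow> 'v \<Rightarrow> real"
  assumes nonneg: "0 \<le> c x y"
    and symmetric: "c x y = c y x"
    and no_loops: "c x x = 0"
    and total_conductance_finite: "(\<lambda>y. c x y) summable_on UNIV"
    and connected: "(\<lambda>x y. c x y > 0)\<^sup>*\<^sup>* x y"

lift_definition finite_energy :: "('v \<Rightarrow> 'v \<Rightarrow> real) \<Rightarrow> 'v potential \<Rightarrow> bool"
  is "\<lambda>c u. (\<lambda>(x, y). c x y * (cmod (u x - u y))\<^sup>2) summable_on UNIV"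
  by auto

definition energy_space :: "('v \<Rightarrow> 'v \<Rightarrow> real) \<Rightarrow> 'v potential set"
  where "energy_space c = {U. finite_energy c U}"

lift_definition energy :: "('v \<Rightarrow> 'v \<Rightarrow> real) \<Rightarrow> 'v potential \<Rightarrow> 'v potential \<Rightarrow> complex"
  is "\<lambda>c u v. 1 / 2 * (\<Sum>\<^sub>\<infinity>(x, y). complex_of_real (c x y) * (cnj (u x) - cnj (u y)) * (v x - v y))"
  by auto

definition energy_norm :: "('v \<Rightarrow> 'v \<Rightarrow> real) \<Rightarrow> 'v potential \<Rightarrow> real"
  where "energy_norm c U = sqrt (Re (energy c U U))"

lift_definition laplacian :: "('v \<Rightarrow> 'v \<Rightarrow> real) \<Rightarrow> 'v potential \<Rightarrow> 'v \<Rightarrow> complex"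
  is "\<lambda>c u x. \<Sum>\<^sub>\<infinity>y. complex_of_real (c x y) * (u x - u y)"
  by (rule ext) auto

definition Harm :: "('v \<Rightarrow> 'v \<Rightarrow> real) \<Rightarrow> 'v potential set"
  where "Harm c = {V \<in> energy_space c. \<forall>x. laplacian c V x = 0}"

definition energy_closure :: "('v \<Rightarrow> 'v \<Rightarrow> real) \<Rightarrow> 'v potential set \<Rightarrow> 'v potential set"
  where "energy_closure c A = {U \<in> energy_space c. \<forall>\<epsilon>>0. \<exists>V\<in>A. energy_norm c (U - V) < \<epsilon>}"

definition energy_proj ::
    "('v \<Rightarrow> 'v \<Rightarrow> real) \<Rightarrow> 'v potential set \<Rightarrow> 'v potential \<Rightarrow> 'v potential"
  where "energy_proj c K U = (THE W. W \<in> K \<and> (\<forall>Z\<in>K. energy c Z (U - W) = 0))"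

definition dirac :: "'v \<Rightarrow> 'v \<Rightarrow> complex"
  where "dirac x y = (if y = x then 1 else 0)"

definition Fin :: "('v \<Rightarrow> 'v \<Rightarrow> real) \<Rightarrow> 'v potential set"
  where "Fin c = energy_closure c (potential.span (range (\<lambda>x. potential_of (dirac x))))"

definition energy_kernel :: "('v \<Rightarrow> 'v \<Rightarrow> real) \<Rightarrow> 'v \<Rightarrow> 'v \<Rightarrow> 'v potential"
  where "energy_kernel c b x =
    (THE V. V \<in> energy_space c \<and> (\<forall>U\<in>energy_space c. energy c V U = pdiff U x b))"

definition fin_kernel :: "('v \<Rightarrow> 'v \<Rightarrow> real) \<Rightarrow> 'v \<Rightarrow> 'v \<Rightarrow> 'v potential"
  where "fin_kernel c b x = energy_proj c (Fin c) (energy_kernel c b x)"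

definition harm_kernel :: "('v \<Rightarrow> 'v \<Rightarrow> real) \<Rightarrow> 'v \<Rightarrow> 'v \<Rightarrow> 'v potential"
  where "harm_kernel c b x = energy_proj c (Harm c) (energy_kernel c b x)"


section \<open>The Laplacian as an operator on the energy space\<close>

definition monopole :: "('v \<Rightarrow> 'v \<Rightarrow> real) \<Rightarrow> 'v \<Rightarrow> 'v potential \<Rightarrow> bool"
  where "monopole c x W \<longleftrightarrow> W \<in> energy_space c \<and> laplacian c W = dirac x"

definition min_monopole :: "('v \<Rightarrow> 'v \<Rightarrow> real) \<Rightarrow> 'v \<Rightarrow> 'v potential"
  where "min_monopole c b =
    (THE W. monopole c b W \<and> (\<forall>W'. monopole c b W' \<longrightarrow> energy_norm c W \<le> energy_norm c W'))"

definition M_domain :: "('v \<Rightarrow> 'v \<Rightarrow> real) \<Rightarrow> 'v \<Rightarrow> 'v potential set"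
  where "M_domain c b =
    (if \<exists>x W. monopole c x W
     then {A + B | A B.
       A \<in> potential.span (range (energy_kernel c b)) \<and>
       B \<in> potential.span (range (\<lambda>x. energy_kernel c b x + min_monopole c b) \<union>
                            range (\<lambda>x. fin_kernel c b x + min_monopole c b))}
     else potential.span (range (energy_kernel c b)))"

text \<open>Unbounded operators on the energy space are represented by their graphs.\<close>

definition Delta_M :: "('v \<Rightarrow> 'v \<Rightarrow> real) \<Rightarrow> 'v \<Rightarrow> ('v potential \<times> 'v potential) set"
  where "Delta_M c b = {(U, V). U \<in> energy_space c \<and> V \<in> energy_space c \<and>
    (\<forall>\<epsilon>>0. \<exists>A\<in>M_domain c b.
       energy_norm c (U - A) < \<epsilon> \<and> energy_norm c (V - potential_of (laplacian c A)) < \<epsilon>)}"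

definition adjoint_op ::
    "('v \<Rightarrow> 'v \<Rightarrow> real) \<Rightarrow> ('v potential \<times> 'v potential) set \<Rightarrow> ('v potential \<times> 'v potential) set"
  where "adjoint_op c T = {(U, V). U \<in> energy_space c \<and> V \<in> energy_space c \<and>
    (\<forall>(A, B)\<in>T. energy c U B = energy c V A)}"

text \<open>An adjoint is a linear subspace, and it is single-valued when the domain is dense; so the graph
  of a self-adjoint \<open>T\<close> in the following sense is automatically that of a linear operator.\<close>

definition self_adjoint :: "('v \<Rightarrow> 'v \<Rightarrow> real) \<Rightarrow> ('v potential \<times> 'v potential) set \<Rightarrow> bool"
  where "self_adjoint c T \<longleftrightarrow>
    energy_closure c (Domain T) = energy_space c \<and> adjoint_op c T = T"

definition op_apply :: "('v potential \<times> 'v potential) set \<Rightarrow> 'v potential \<Rightarrow> 'v potential"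
  where "op_apply T U = (THE V. (U, V) \<in> T)"

text \<open>For a projection-valued measure \<open>E\<close>, \<open>scalar_spectral_measure c E U\<close> is the measure
  \<open>B \<mapsto> \<langle>U, E B U\<rangle>\<close>.\<close>

definition projection_valued_measure ::
    "('v \<Rightarrow> 'v \<Rightarrow> real) \<Rightarrow> (real set \<Rightarrow> 'v potential \<Rightarrow> 'v potential) \<Rightarrow> bool"
  where "projection_valued_measure c E \<longleftrightarrow>
    (\<forall>B\<in>sets borel. \<forall>U\<in>energy_space c. E B U \<in> energy_space c) \<and>
    (\<forall>B\<in>sets borel. \<forall>U\<in>energy_space c. \<forall>V\<in>energy_space c.
       energy c U (E B V) = energy c (E B U) V) \<and>
    (\<forall>U\<in>energy_space c. E UNIV U = U) \<and>
    (\<forall>A\<in>sets borel. \<forall>B\<in>sets borel. \<forall>U\<in>energy_space c. E A (E B U) = E (A \<inter> B) U) \<and>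
    (\<forall>A :: nat \<Rightarrow> real set. range A \<subseteq> sets borel \<longrightarrow> disjoint_family A \<longrightarrow>
       (\<forall>U\<in>energy_space c. (\<lambda>n. energy c U (E (A n) U)) sums energy c U (E (\<Union>n. A n) U)))"

definition scalar_spectral_measure ::
    "('v \<Rightarrow> 'v \<Rightarrow> real) \<Rightarrow> (real set \<Rightarrow> 'v potential \<Rightarrow> 'v potential) \<Rightarrow> 'v potential \<Rightarrow> real measure"
  where "scalar_spectral_measure c E U =
    measure_of UNIV (sets borel) (\<lambda>B. ennreal (Re (energy c U (E B U))))"

text \<open>\<open>T = \<integral>t dE(t)\<close>; by polarization the quadratic form on the domain determines the operator.\<close>

definition is_spectral_measure ::
    "('v \<Rightarrow> 'v \<Rightarrow> real) \<Rightarrow> ('v potential \<times> 'v potential) set \<Rightarrow>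
     (real set \<Rightarrow> 'v potential \<Rightarrow> 'v potential) \<Rightarrow> bool"
  where "is_spectral_measure c T E \<longleftrightarrow>
    projection_valued_measure c E \<and>
    Domain T = {U \<in> energy_space c. integrable (scalar_spectral_measure c E U) (\<lambda>t. t\<^sup>2)} \<and>
    (\<forall>(U, V)\<in>T. energy c U V = complex_of_real (\<integral>t. t \<partial>scalar_spectral_measure c E U))"

text \<open>By the spectral theorem, for self-adjoint \<open>T\<close> a spectral measure exists and is unique on Borel
  sets and on the energy space.\<close>

definition spectral_proj ::
    "('v \<Rightarrow> 'v \<Rightarrow> real) \<Rightarrow> ('v potential \<times> 'v potential) set \<Rightarrow>
     real set \<Rightarrow> 'v potential \<Rightarrow> 'v potential"
  where "spectral_proj c T = (SOME E. is_spectral_measure c T E)"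


section \<open>Test functions, distributions and the pairing\<close>

definition test_space :: "('v potential \<times> 'v potential) set \<Rightarrow> 'v potential set"
  where "test_space T = {U. real_valued U \<and> (\<forall>p\<ge>1. U \<in> Domain (T ^^ p))}"

text \<open>The seminorm with \<open>p = 0\<close>, i.e. the energy norm itself, is included, so that the topology is
  Hausdorff and the inclusion into the energy space is continuous even if \<open>T\<close> has a kernel.\<close>

definition test_seminorm ::
    "('v \<Rightarrow> 'v \<Rightarrow> real) \<Rightarrow> ('v potential \<times> 'v potential) set \<Rightarrow> nat \<Rightarrow> 'v potential \<Rightarrow> real"
  where "test_seminorm c T p U = energy_norm c (op_apply (T ^^ p) U)"

definition test_topology ::
    "('v \<Rightarrow> 'v \<Rightarrow> real) \<Rightarrow> ('v potential \<times> 'v potential) set \<Rightarrow> 'v potential topology"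
  where "test_topology c T = topology_generated_by
    {{V \<in> test_space T. test_seminorm c T p (V - U) < r} | U p r. U \<in> test_space T \<and> r > 0}"

definition distributions ::
    "('v \<Rightarrow> 'v \<Rightarrow> real) \<Rightarrow> ('v potential \<times> 'v potential) set \<Rightarrow> ('v potential \<Rightarrow> real) set"
  where "distributions c T = {\<xi> \<in> extensional (test_space T).
    (\<forall>U\<in>test_space T. \<forall>V\<in>test_space T. \<xi> (U + V) = \<xi> U + \<xi> V) \<and>
    (\<forall>a :: real. \<forall>U\<in>test_space T. \<xi> (cscale (complex_of_real a) U) = a * \<xi> U) \<and>
    continuous_map (test_topology c T) euclideanreal \<xi>}"

text \<open>The topology on the dual is the weak-* topology.  A Radon measure for the strong dual topology
  restricts to one for the weak-* topology, and the pairings with test functions are already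
  weak-* continuous.\<close>

definition weak_star_topology ::
    "('v \<Rightarrow> 'v \<Rightarrow> real) \<Rightarrow> ('v potential \<times> 'v potential) set \<Rightarrow> ('v potential \<Rightarrow> real) topology"
  where "weak_star_topology c T =
    subtopology (product_topology (\<lambda>_. euclideanreal) (test_space T)) (distributions c T)"

definition radon_probability :: "'b topology \<Rightarrow> 'b measure \<Rightarrow> bool"
  where "radon_probability X P \<longleftrightarrow>
    prob_space P \<and> space P = topspace X \<and> sets P = sigma_sets (topspace X) {A. openin X A} \<and>
    (\<forall>A\<in>sets P. emeasure P A = (SUP K\<in>{K \<in> sets P. compactin X K \<and> K \<subseteq> A}. emeasure P K))"

text \<open>For a test function \<open>U\<close>, the vector \<open>\<Delta>\<^sup>-\<^sup>p \<xi>\<close> is by definition the Riesz representative of the functional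
  \<open>\<Delta>\<^sup>p U \<mapsto> \<xi> U\<close>, so \<open>\<langle>\<Delta>\<^sup>p U, \<Delta>\<^sup>-\<^sup>p \<xi>\<rangle> = \<xi> U\<close> for every admissible \<open>p\<close>; this is the first branch.  The second
  branch is the limit of \<open>\<xi> (E\<^sub>n U)\<close> with \<open>E\<^sub>n\<close> the spectral projection for \<open>[1/n, n]\<close>.  On test functions
  the limit gives the same value unless \<open>T\<close> has a kernel: \<open>E\<^sub>n\<close> annihilates the kernel of \<open>T\<close> (which contains
  the harmonic elements), while \<open>\<xi>\<close> need not.\<close>

definition real_pairing ::
    "('v \<Rightarrow> 'v \<Rightarrow> real) \<Rightarrow> ('v potential \<times> 'v potential) set \<Rightarrow>
     'v potential \<Rightarrow> ('v potential \<Rightarrow> real) \<Rightarrow> real"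
  where "real_pairing c T U \<xi> =
    (if U \<in> test_space T then \<xi> U
     else lim (\<lambda>n::nat. \<xi> (spectral_proj c T {1 / real n..real n} U)))"

definition pairing ::
    "('v \<Rightarrow> 'v \<Rightarrow> real) \<Rightarrow> ('v potential \<times> 'v potential) set \<Rightarrow>
     'v potential \<Rightarrow> ('v potential \<Rightarrow> real) \<Rightarrow> complex"
  where "pairing c T U \<xi> =
    complex_of_real (real_pairing c T (pRe U) \<xi>) + \<i> * complex_of_real (real_pairing c T (pIm U) \<xi>)"

end

theory Submission
  imports Defs
begin

text \<open>
  Write \<open>T\<close> for the given self-adjoint extension, \<open>v\<^sub>x\<close> for the energy kernel, \<open>f\<^sub>x\<close> for its projection
  to \<open>Fin\<close> and \<open>h\<^sub>x\<close> for its projection to \<open>Harm\<close>.  Two facts give the formula.  On the probability side,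
  the characteristic functional makes \<open>\<xi> \<mapsto> \<xi> s\<close> a centred Gaussian variable of variance
  \<open>\<parallel>s\<parallel>\<^sup>2\<close> for every test function \<open>s\<close>, so by polarization \<open>\<integral> \<xi> s * \<xi> t dP = Re \<langle>s, t\<rangle>\<close>
  (\<open>second_moment_if_gaussian\<close>, \<open>white_noise_covariance\<close>).  On the energy side, \<open>h\<^sub>x\<close> is a real-valued
  reproducing kernel of \<open>Harm\<close>: \<open>\<langle>h\<^sub>x, u\<rangle> = u x - u b\<close> (\<open>energy_harm_kernel\<close>, \<open>harm_kernel_real\<close>).
  Applying the first fact to the real and imaginary parts of \<open>u\<close>, paired with \<open>h\<^sub>x\<close>, gives the theorem.

  For this the real harmonic elements have to be test functions; they are, because \<open>T\<close> vanishes on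
  \<open>Harm\<close> (\<open>Harm_in_ker_self_adjoint\<close>).  There are two cases.

  If a monopole exists, the domain of the Laplacian contains \<open>v\<^sub>x + w\<close> and \<open>f\<^sub>x + w\<close>, hence their difference
  \<open>h\<^sub>x = v\<^sub>x - f\<^sub>x\<close>, which is therefore in the kernel of \<open>T\<close>.  Every \<open>B\<close> in the range of \<open>T\<close> is orthogonal
  to the kernel of \<open>T\<close>, in particular to each \<open>h\<^sub>x\<close>; so the harmonic component \<open>g\<close> of \<open>B\<close> satisfies
  \<open>g x = g b\<close> for all \<open>x\<close>, that is \<open>g = 0\<close>.  Thus the range of \<open>T\<close> lies in \<open>Fin\<close>, which is orthogonal to
  \<open>Harm\<close>, and then \<open>(U, 0)\<close> belongs to the adjoint of \<open>T\<close>, which is \<open>T\<close>, for every harmonic \<open>U\<close>.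

  If no monopole exists, \<open>Harm = 0\<close> (\<open>Harm_trivial_if_no_monopole\<close>).  A monopole at \<open>b\<close> is a Riesz
  representative of \<open>\<phi> \<mapsto> \<phi> b\<close> on the finitely supported functions; its absence makes this functional
  unbounded, which gives finitely supported \<open>\<psi>\<^sub>n \<ge> 0\<close> with \<open>\<psi>\<^sub>n b = 1\<close> and energy tending to \<open>0\<close>.  Testing a
  harmonic \<open>r\<close> against \<open>\<psi>\<^sub>n\<close> times a truncation of \<open>r\<close> shows that \<open>r\<close> is constant along every edge.

  The Hilbert space results used on the way are derived from the completeness of the energy space
  (\<open>energy_space_complete\<close>) by one version of the Riesz representation theorem (\<open>riesz_representation\<close>),
  which yields the energy kernel, the projection to \<open>Fin\<close> and the monopoles.
\<close>


section \<open>Functions modulo constants\<close>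

text \<open>Differences \<open>pdiff U x y\<close> determine a class modulo constants, and energy, energy norm and
  Laplacian are expressed through them; so the quotient construction is used in this part only.\<close>


lemma potential_eq_iff: "U = V \<longleftrightarrow> (\<forall>x y. pdiff U x y = pdiff V x y)"
proof (transfer, intro iffI allI)
  fix u v :: "'a \<Rightarrow> complex" and x y
  assume "\<exists>k. \<forall>x. u x = v x + k"
  then obtain k where "\<And>x. u x = v x + k" by blast
  then show "u x - u y = v x - v y" by simp
next
  fix u v :: "'a \<Rightarrow> complex"
  assume *: "\<forall>x y. u x - u y = v x - v y"
  show "\<exists>k. \<forall>x. u x = v x + k"
  proof (rule exI[of _ "u undefined - v undefined"], rule allI)
    fix x
    show "u x = v x + (u undefined - v undefined)"
      using *[rule_format, of x undefined] by (simp add: diff_eq_eq)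
  qed
qed

lemma pdiff_potential_of [simp]: "pdiff (potential_of u) x y = u x - u y"
  by transfer simp

lemma pdiff_zero [simp]: "pdiff 0 x y = 0"
  by transfer simp

lemma pdiff_add [simp]: "pdiff (U + V) x y = pdiff U x y + pdiff V x y"
  by transfer simp

lemma pdiff_uminus [simp]: "pdiff (- U) x y = - pdiff U x y"
  by transfer simp

lemma pdiff_diff [simp]: "pdiff (U - V) x y = pdiff U x y - pdiff V x y"
  using pdiff_add[of U "- V" x y] by (simp del: pdiff_add)

lemma pdiff_cscale [simp]: "pdiff (cscale a U) x y = a * pdiff U x y"
  by transfer (simp add: algebra_simps)

lemma pdiff_pRe [simp]: "pdiff (pRe U) x y = complex_of_real (Re (pdiff U x y))"
  by transfer simp

lemma pdiff_pIm [simp]: "pdiff (pIm U) x y = complex_of_real (Im (pdiff U x y))"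
  by transfer simp

lemma pdiff_same [simp]: "pdiff U x x = 0"
  by transfer simp

lemma pdiff_swap: "pdiff U y x = - pdiff U x y"
  by transfer simp

lemma pdiff_triangle: "pdiff U x z = pdiff U x y + pdiff U y z"
  by transfer simp

lemma potential_of_surj: "\<exists>u. U = potential_of u"
  by transfer (metis add.right_neutral)

lemma real_valued_pRe: "real_valued (pRe U)"
proof -
  obtain u where "U = potential_of u" using potential_of_surj by blast
  then have "pRe U = potential_of (\<lambda>x. complex_of_real (Re (u x)))"
    by (simp add: potential_eq_iff)
  then show ?thesis unfolding real_valued_def by (rule exI[of _ "\<lambda>x. Re (u x)"])
qed

lemma real_valued_pIm: "real_valued (pIm U)"
proof -
  obtain u where "U = potential_of u" using potential_of_surj by blast
  then have "pIm U = potential_of (\<lambda>x. complex_of_real (Im (u x)))"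
    by (simp add: potential_eq_iff)
  then show ?thesis unfolding real_valued_def by (rule exI[of _ "\<lambda>x. Im (u x)"])
qed

lemma pRe_plus_i_pIm: "U = pRe U + cscale \<i> (pIm U)"
  by (simp add: potential_eq_iff flip: complex_eq)

lemma in_energy_space_iff:
  "U \<in> energy_space c \<longleftrightarrow> (\<lambda>(x, y). c x y * (cmod (pdiff U x y))\<^sup>2) summable_on UNIV"
  unfolding energy_space_def mem_Collect_eq by transfer simp

lemma energy_pdiff:
  "energy c U V = 1 / 2 * (\<Sum>\<^sub>\<infinity>(x, y). complex_of_real (c x y) * cnj (pdiff U x y) * pdiff V x y)"
  by transfer simp

lemma laplacian_pdiff:
  "laplacian c U x = (\<Sum>\<^sub>\<infinity>y. complex_of_real (c x y) * pdiff U x y)"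
  by transfer simp

section \<open>The energy form\<close>

lemma infsum_complex_of_real: "infsum (\<lambda>x. complex_of_real (f x)) A = complex_of_real (infsum f A)"
proof (cases "f summable_on A")
  case True
  then show ?thesis by (intro infsumI has_sum_of_real has_sum_infsum)
next
  case False
  then have "\<not> (\<lambda>x. complex_of_real (f x)) summable_on A"
    using summable_on_Re[of "\<lambda>x. complex_of_real (f x)" A] by auto
  with False show ?thesis by (simp add: infsum_not_exists)
qed

context resistance_network
begin

abbreviation "H \<equiv> energy_space c"

text \<open>Since \<open>a b \<le> a\<^sup>2 + b\<^sup>2\<close> edge by edge, the sum defining \<open>energy c U V\<close> converges absolutely.\<close>
lemma edge_product_abs_summable:
  assumes "U \<in> H" "V \<in> H"
  shows "(\<lambda>(x, y). c x y * (cmod (pdiff U x y) * cmod (pdiff V x y))) summable_on UNIV"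
proof -
  have *: "c x y * (cmod (pdiff U x y) * cmod (pdiff V x y))
      \<le> c x y * (cmod (pdiff U x y))\<^sup>2 + c x y * (cmod (pdiff V x y))\<^sup>2" for x y
  proof -
    let ?a = "cmod (pdiff U x y)" and ?b = "cmod (pdiff V x y)"
    have "?a * ?b \<le> ?a\<^sup>2 + ?b\<^sup>2"
      using sum_squares_bound[of ?a ?b] mult_nonneg_nonneg[of ?a ?b, OF norm_ge_zero norm_ge_zero]
      by linarith
    from mult_left_mono[OF this nonneg[of x y]] show ?thesis by (simp only: distrib_left)
  qed
  have "(\<lambda>(x, y). c x y * (cmod (pdiff U x y))\<^sup>2 + c x y * (cmod (pdiff V x y))\<^sup>2) summable_on UNIV"
    using summable_on_add[OF assms[unfolded in_energy_space_iff]] by (simp add: case_prod_unfold)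
  then show ?thesis
    by (rule summable_on_comparison_test) (use * nonneg in auto)
qed

lemma edge_product_summable:
  assumes "U \<in> H" "V \<in> H"
  shows "(\<lambda>(x, y). complex_of_real (c x y) * cnj (pdiff U x y) * pdiff V x y) summable_on UNIV"
proof (rule abs_summable_summable)
  have "(\<lambda>p. norm (case p of (x, y) \<Rightarrow> complex_of_real (c x y) * cnj (pdiff U x y) * pdiff V x y))
      = (\<lambda>(x, y). c x y * (cmod (pdiff U x y) * cmod (pdiff V x y)))"
    by (auto simp: norm_mult nonneg)
  then show "(\<lambda>p. norm (case p of (x, y) \<Rightarrow> complex_of_real (c x y) * cnj (pdiff U x y) * pdiff V x y))
      summable_on UNIV"
    using edge_product_abs_summable[OF assms] by simp
qed

lemma zero_in_H [simp]: "0 \<in> H"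
  by (simp add: in_energy_space_iff case_prod_unfold)

lemma cscale_in_H [simp]: assumes "U \<in> H" shows "cscale a U \<in> H"
proof -
  have "(\<lambda>(x, y). c x y * (cmod (pdiff (cscale a U) x y))\<^sup>2)
      = (\<lambda>p. (cmod a)\<^sup>2 * (case p of (x, y) \<Rightarrow> c x y * (cmod (pdiff U x y))\<^sup>2))"
    by (auto simp: norm_mult power_mult_distrib)
  then show ?thesis
    using assms unfolding in_energy_space_iff by (simp only: summable_on_cmult_right)
qed

lemma add_in_H [simp]:
  assumes "U \<in> H" "V \<in> H" shows "U + V \<in> H"
proof -
  have *: "c x y * (cmod (pdiff (U + V) x y))\<^sup>2
      \<le> 2 * (c x y * (cmod (pdiff U x y))\<^sup>2 + c x y * (cmod (pdiff V x y))\<^sup>2)" for x y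
  proof -
    let ?a = "cmod (pdiff U x y)" and ?b = "cmod (pdiff V x y)"
    have "(cmod (pdiff (U + V) x y))\<^sup>2 \<le> (?a + ?b)\<^sup>2"
      by (auto intro!: power_mono norm_triangle_ineq)
    also have "\<dots> \<le> 2 * (?a\<^sup>2 + ?b\<^sup>2)"
      using sum_squares_bound[of ?a ?b] by (simp add: power2_sum)
    finally have "c x y * (cmod (pdiff (U + V) x y))\<^sup>2 \<le> c x y * (2 * (?a\<^sup>2 + ?b\<^sup>2))"
      by (rule mult_left_mono) (rule nonneg)
    then show ?thesis by (simp add: algebra_simps)
  qed
  have "(\<lambda>(x, y). 2 * (c x y * (cmod (pdiff U x y))\<^sup>2 + c x y * (cmod (pdiff V x y))\<^sup>2)) summable_on UNIV"
    using summable_on_cmult_right[OF summable_on_add[OF assms[unfolded in_energy_space_iff]], of 2]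
    by (simp add: case_prod_unfold)
  then show ?thesis unfolding in_energy_space_iff
    by (rule summable_on_comparison_test) (use * nonneg in \<open>auto simp del: pdiff_add\<close>)
qed

lemma uminus_in_H [simp]: "U \<in> H \<Longrightarrow> - U \<in> H"
  by (simp add: in_energy_space_iff)

lemma diff_in_H [simp]: "U \<in> H \<Longrightarrow> V \<in> H \<Longrightarrow> U - V \<in> H"
  unfolding minus_potential_def by (intro add_in_H uminus_in_H)

lemma in_H_if_pdiff_le:
  assumes "U \<in> H" "\<And>x y. cmod (pdiff V x y) \<le> cmod (pdiff U x y)"
  shows "V \<in> H"
  using assms(1) unfolding in_energy_space_iff
  by (rule summable_on_comparison_test) (auto simp: nonneg assms(2) intro!: mult_left_mono power_mono)

lemma pRe_in_H [simp]: "U \<in> H \<Longrightarrow> pRe U \<in> H"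
  by (erule in_H_if_pdiff_le) (simp add: abs_Re_le_cmod)

lemma pIm_in_H [simp]: "U \<in> H \<Longrightarrow> pIm U \<in> H"
  by (erule in_H_if_pdiff_le) (simp add: abs_Im_le_cmod)

lemma energy_add_right:
  "U \<in> H \<Longrightarrow> V \<in> H \<Longrightarrow> W \<in> H \<Longrightarrow> energy c U (V + W) = energy c U V + energy c U W"
  unfolding energy_pdiff
  using infsum_add[OF edge_product_summable[of U V] edge_product_summable[of U W]]
  by (simp add: case_prod_unfold algebra_simps)

lemma energy_cscale_right: "energy c U (cscale a V) = a * energy c U V"
  unfolding energy_pdiff
  using infsum_cmult_right'[of a "\<lambda>(x, y). complex_of_real (c x y) * cnj (pdiff U x y) * pdiff V x y" UNIV]
  by (simp add: case_prod_unfold mult_ac)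

lemma energy_cnj: "energy c V U = cnj (energy c U V)"
  unfolding energy_pdiff
  by (simp add: case_prod_unfold mult_ac flip: infsum_cnj)

lemma energy_zero_right [simp]: "energy c U 0 = 0"
  by (simp add: energy_pdiff case_prod_unfold)

lemma energy_zero_left [simp]: "energy c 0 U = 0"
  by (simp add: energy_pdiff case_prod_unfold)

lemma energy_uminus_right: "energy c U (- V) = - energy c U V"
  unfolding energy_pdiff by (simp add: case_prod_unfold infsum_uminus)

lemma energy_diff_right:
  "U \<in> H \<Longrightarrow> V \<in> H \<Longrightarrow> W \<in> H \<Longrightarrow> energy c U (V - W) = energy c U V - energy c U W"
  using energy_add_right[of U V "- W"] by (simp add: energy_uminus_right)

lemma energy_add_left:
  "U \<in> H \<Longrightarrow> V \<in> H \<Longrightarrow> W \<in> H \<Longrightarrow> energy c (U + V) W = energy c U W + energy c V W"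
  by (subst (1 2 3) energy_cnj) (simp add: energy_add_right)

lemma energy_diff_left:
  "U \<in> H \<Longrightarrow> V \<in> H \<Longrightarrow> W \<in> H \<Longrightarrow> energy c (U - V) W = energy c U W - energy c V W"
  by (subst (1 2 3) energy_cnj) (simp add: energy_diff_right)

lemma energy_cscale_left: "energy c (cscale a U) V = cnj a * energy c U V"
  by (subst (1 2) energy_cnj) (simp add: energy_cscale_right)

lemma energy_self: "energy c U U = complex_of_real (1 / 2 * (\<Sum>\<^sub>\<infinity>(x, y). c x y * (cmod (pdiff U x y))\<^sup>2))"
proof -
  have "complex_of_real (c x y) * cnj (pdiff U x y) * pdiff U x y
      = complex_of_real (c x y * (cmod (pdiff U x y))\<^sup>2)" for x y
    using complex_norm_square[of "pdiff U x y"] by (simp add: mult_ac)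
  then show ?thesis
    unfolding energy_pdiff by (simp add: case_prod_unfold infsum_complex_of_real flip: of_real_mult)
qed

lemma energy_norm_sq: "(energy_norm c U)\<^sup>2 = 1 / 2 * (\<Sum>\<^sub>\<infinity>(x, y). c x y * (cmod (pdiff U x y))\<^sup>2)"
  unfolding energy_norm_def energy_self
  by (simp add: infsum_nonneg nonneg case_prod_unfold)

lemma energy_self_norm: "energy c U U = complex_of_real ((energy_norm c U)\<^sup>2)"
  unfolding energy_norm_sq energy_self ..

lemma energy_norm_nonneg [simp]: "0 \<le> energy_norm c U"
  unfolding energy_norm_def energy_self by (simp add: infsum_nonneg nonneg case_prod_unfold)

lemma energy_norm_zero [simp]: "energy_norm c 0 = 0"
  by (simp add: energy_norm_def)

lemma energy_norm_cscale: "energy_norm c (cscale a U) = cmod a * energy_norm c U"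
proof (rule power2_eq_imp_eq)
  have "energy c (cscale a U) (cscale a U) = complex_of_real ((cmod a)\<^sup>2) * energy c U U"
    by (simp only: energy_cscale_left energy_cscale_right complex_norm_square mult_ac)
  then have "complex_of_real ((energy_norm c (cscale a U))\<^sup>2) = complex_of_real ((cmod a * energy_norm c U)\<^sup>2)"
    unfolding energy_self_norm power_mult_distrib of_real_mult .
  then show "(energy_norm c (cscale a U))\<^sup>2 = (cmod a * energy_norm c U)\<^sup>2"
    by (simp only: of_real_eq_iff)
qed auto

lemma energy_norm_minus_commute: "energy_norm c (U - V) = energy_norm c (V - U)"
  unfolding energy_norm_def energy_pdiff
  by (simp add: case_prod_unfold algebra_simps)

lemma energy_norm_add_sq:
  assumes "U \<in> H" "V \<in> H"
  shows "(energy_norm c (U + V))\<^sup>2 = (energy_norm c U)\<^sup>2 + 2 * Re (energy c U V) + (energy_norm c V)\<^sup>2"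
proof -
  have "complex_of_real ((energy_norm c (U + V))\<^sup>2)
      = complex_of_real ((energy_norm c U)\<^sup>2) + (energy c U V + cnj (energy c U V)) + complex_of_real ((energy_norm c V)\<^sup>2)"
    unfolding energy_self_norm[symmetric] using assms energy_cnj[of V U]
    by (simp add: energy_add_left energy_add_right)
  from arg_cong[OF this, of Re] show ?thesis by simp
qed

lemma energy_norm_diff_sq:
  assumes "U \<in> H" "V \<in> H"
  shows "(energy_norm c (U - V))\<^sup>2 = (energy_norm c U)\<^sup>2 - 2 * Re (energy c U V) + (energy_norm c V)\<^sup>2"
  using energy_norm_add_sq[of U "- V"] energy_norm_minus_commute[of 0 V] assms
  by (simp add: energy_uminus_right)

lemma energy_norm_mono:
  assumes "U \<in> H" "\<And>x y. cmod (pdiff V x y) \<le> cmod (pdiff U x y)"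
  shows "energy_norm c V \<le> energy_norm c U"
proof (rule power2_le_imp_le)
  have "V \<in> H" using in_H_if_pdiff_le[OF assms] .
  with assms(1) show "(energy_norm c V)\<^sup>2 \<le> (energy_norm c U)\<^sup>2"
    unfolding energy_norm_sq in_energy_space_iff
    by (auto intro!: infsum_mono mult_left_mono power_mono simp: nonneg assms(2))
qed simp

text \<open>The usual discriminant argument: \<open>quad\<close> is \<open>\<parallel>V - t \<langle>U, V\<rangle> U\<parallel>\<^sup>2 \<ge> 0\<close>.\<close>
lemma energy_cauchy_schwarz:
  assumes "U \<in> H" "V \<in> H"
  shows "cmod (energy c U V) \<le> energy_norm c U * energy_norm c V"
proof -
  define e where "e = energy c U V"
  have quad: "0 \<le> (cmod e)\<^sup>2 * t\<^sup>2 * (energy_norm c U)\<^sup>2 - 2 * t * (cmod e)\<^sup>2 + (energy_norm c V)\<^sup>2" for t :: real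
  proof -
    have "0 \<le> (energy_norm c (cscale (- of_real t * e) U + V))\<^sup>2" by simp
    also have "\<dots> = (t * cmod e * energy_norm c U)\<^sup>2 + 2 * Re (cnj (- of_real t * e) * e) + (energy_norm c V)\<^sup>2"
      unfolding energy_norm_add_sq[OF cscale_in_H[OF assms(1)] assms(2)]
      unfolding energy_norm_cscale energy_cscale_left e_def[symmetric]
      by (simp add: norm_mult power_mult_distrib)
    also have "Re (cnj (- of_real t * e) * e) = - t * (cmod e)\<^sup>2"
      by (simp add: cmod_power2) (simp add: power2_eq_square algebra_simps)
    finally show ?thesis by (simp add: power_mult_distrib mult_ac)
  qed
  \<comment> \<open>With \<open>\<parallel>U\<parallel> = 0\<close> the quadratic is linear in \<open>t\<close>, so a large \<open>t\<close> forces \<open>e = 0\<close>; otherwise take its minimizer.\<close>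
  show ?thesis
  proof (cases "energy_norm c U = 0")
    case True
    have "cmod e = 0"
    proof (rule ccontr)
      assume "cmod e \<noteq> 0"
      then show False
        using quad[of "((energy_norm c V)\<^sup>2 + 1) / (2 * (cmod e)\<^sup>2)"] True by simp
    qed
    with True show ?thesis by (simp add: e_def)
  next
    case False
    let ?a = "energy_norm c U"
    have "0 \<le> (cmod e)\<^sup>2 * (1 / ?a\<^sup>2)\<^sup>2 * ?a\<^sup>2 - 2 * (1 / ?a\<^sup>2) * (cmod e)\<^sup>2 + (energy_norm c V)\<^sup>2"
      by (rule quad)
    also have "\<dots> = - (cmod e)\<^sup>2 / ?a\<^sup>2 + (energy_norm c V)\<^sup>2"
      using False by (simp add: field_simps power2_eq_square)
    finally have "(cmod e)\<^sup>2 \<le> (?a * energy_norm c V)\<^sup>2"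
      using False by (simp add: field_simps power_mult_distrib)
    then show ?thesis unfolding e_def by (rule power2_le_imp_le) simp
  qed
qed

text \<open>An edge \<open>y z\<close> contributes \<open>c y z * \<bar>U y - U z\<bar>\<^sup>2\<close> to the energy, which bounds the difference along that
  edge; summing along a path from \<open>x\<close> to \<open>y\<close> makes point differences energy-continuous.\<close>
lemma pdiff_bound: "\<exists>C\<ge>0. \<forall>U\<in>H. cmod (pdiff U x y) \<le> C * energy_norm c U"
  using connected[of x y]
proof (induction rule: rtranclp_induct)
  case base
  show ?case by (intro exI[of _ 0]) simp
next
  case (step y z)
  then obtain C where C: "C \<ge> 0" "\<And>U. U \<in> H \<Longrightarrow> cmod (pdiff U x y) \<le> C * energy_norm c U" by blast
  \<comment> \<open>The factor 2 is the inverse of the \<open>1 / 2\<close> in the definition of the energy.\<close>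
  define K where "K = sqrt (2 / c y z)"
  have K: "cmod (pdiff U y z) \<le> K * energy_norm c U" if "U \<in> H" for U
  proof (rule power2_le_imp_le)
    have "(\<Sum>p\<in>{(y, z)}. (\<lambda>(x, y). c x y * (cmod (pdiff U x y))\<^sup>2) p) \<le> 2 * (energy_norm c U)\<^sup>2"
      unfolding energy_norm_sq using finite_sum_le_infsum[OF that[unfolded in_energy_space_iff], of "{(y, z)}"]
      by (simp add: nonneg case_prod_unfold)
    then show "(cmod (pdiff U y z))\<^sup>2 \<le> (K * energy_norm c U)\<^sup>2"
      using \<open>0 < c y z\<close> by (simp add: K_def power_mult_distrib field_simps)
  qed (use \<open>0 < c y z\<close> in \<open>simp add: K_def\<close>)
  have "cmod (pdiff U x z) \<le> (C + K) * energy_norm c U" if "U \<in> H" for U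
    using add_mono[OF C(2)[OF that] K[OF that]] norm_triangle_ineq[of "pdiff U x y" "pdiff U y z"]
    unfolding distrib_right pdiff_triangle[of U x z y] by linarith
  moreover have "C + K \<ge> 0" using C(1) \<open>0 < c y z\<close> by (simp add: K_def)
  ultimately show ?case by blast
qed

lemma energy_norm_eq_0_iff: "U \<in> H \<Longrightarrow> energy_norm c U = 0 \<longleftrightarrow> U = 0"
proof
  assume "U \<in> H" "energy_norm c U = 0"
  then have "pdiff U x y = 0" for x y using pdiff_bound[of x y] by fastforce
  then show "U = 0" by (simp add: potential_eq_iff)
qed simp

lemma energy_self_eq_0: "U \<in> H \<Longrightarrow> energy c U U = 0 \<Longrightarrow> U = 0"
  using energy_norm_eq_0_iff[of U] by (simp add: energy_self_norm)

end


section \<open>Green's formula and harmonic elements\<close>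

text \<open>For a Dirac mass at \<open>x\<close> only the row and the column of \<open>x\<close> contribute to a sum over ordered pairs
  of vertices; this lemma and the next extend these partial sums by zero.\<close>
lemma has_sum_row:
  fixes f :: "'b \<Rightarrow> 'c :: {comm_monoid_add, topological_space}"
  assumes "(f has_sum s) UNIV"
  shows "((\<lambda>(y, z). if y = x then f z else 0) has_sum s) UNIV"
proof -
  have "((\<lambda>(y, z). if y = x then f z else 0) has_sum s) (range (Pair x))"
    using assms by (subst has_sum_reindex) (auto simp: inj_on_def o_def)
  then show ?thesis by (rule has_sum_cong_neutral[THEN iffD1, rotated -1]) auto
qed

lemma has_sum_column:
  fixes f :: "'b \<Rightarrow> 'c :: {comm_monoid_add, topological_space}"
  assumes "(f has_sum s) UNIV"
  shows "((\<lambda>(y, z). if z = x then f y else 0) has_sum s) UNIV"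
proof -
  have "((\<lambda>(y, z). if z = x then f y else 0) has_sum s) (range (\<lambda>y. (y, x)))"
    using assms by (subst has_sum_reindex) (auto simp: inj_on_def o_def)
  then show ?thesis by (rule has_sum_cong_neutral[THEN iffD1, rotated -1]) auto
qed

context resistance_network
begin

text \<open>From \<open>t \<le> 1 + t\<^sup>2\<close>: the sum is dominated by the total conductance at \<open>x\<close> plus the energy of the edges
  at \<open>x\<close>.\<close>
lemma laplacian_summable:
  assumes "U \<in> H"
  shows "(\<lambda>y. complex_of_real (c x y) * pdiff U x y) summable_on UNIV"
proof (rule abs_summable_summable)
  have *: "t \<le> 1 + t\<^sup>2" for t :: real
    using sum_squares_bound[of t 1] zero_le_power2[of t] by (simp, linarith)
  have bound: "norm (complex_of_real (c x y) * pdiff U x y) \<le> c x y + c x y * (cmod (pdiff U x y))\<^sup>2" for y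
    using mult_left_mono[OF *[of "cmod (pdiff U x y)"] nonneg[of x y]]
    by (simp add: norm_mult nonneg distrib_left)
  have "(\<lambda>(x, y). c x y * (cmod (pdiff U x y))\<^sup>2) summable_on (range (Pair x))"
    using assms[unfolded in_energy_space_iff] by (rule summable_on_subset_banach) simp
  then have "(\<lambda>y. c x y * (cmod (pdiff U x y))\<^sup>2) summable_on UNIV"
    by (subst (asm) summable_on_reindex) (auto simp: inj_on_def o_def)
  from summable_on_add[OF total_conductance_finite[of x] this]
  show "(\<lambda>y. norm (complex_of_real (c x y) * pdiff U x y)) summable_on UNIV"
    by (rule summable_on_comparison_test) (use bound in auto)
qed

lemma dirac_in_H [simp]: "potential_of (dirac x) \<in> H"
proof -
  have "((\<lambda>z. c x z) has_sum (\<Sum>\<^sub>\<infinity>z. c x z)) UNIV"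
    using total_conductance_finite by (rule has_sum_infsum)
  from has_sum_add[OF has_sum_row[OF this] has_sum_column[OF this]]
  have "(\<lambda>p. (case p of (y, z) \<Rightarrow> if y = x then c x z else 0)
            + (case p of (y, z) \<Rightarrow> if z = x then c x y else 0)) summable_on UNIV"
    by (rule has_sum_imp_summable)
  also have "(\<lambda>p. (case p of (y, z) \<Rightarrow> if y = x then c x z else 0)
            + (case p of (y, z) \<Rightarrow> if z = x then c x y else 0))
     = (\<lambda>(y, z). c y z * (cmod (pdiff (potential_of (dirac x)) y z))\<^sup>2)"
    by (auto simp: dirac_def fun_eq_iff no_loops symmetric)
  finally show ?thesis unfolding in_energy_space_iff .
qed

text \<open>Green's formula for a Dirac mass.  The row and the column of \<open>x\<close> each contribute \<open>laplacian c U x\<close>, and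
  the factor \<open>1 / 2\<close> of the energy compensates for the two.\<close>
lemma energy_dirac:
  assumes "U \<in> H"
  shows "energy c (potential_of (dirac x)) U = laplacian c U x"
proof -
  \<comment> \<open>Loops carry no conductance, so the pair \<open>(x, x)\<close>, which lies in the row and in the column, contributes 0.\<close>
  have "((\<lambda>z. complex_of_real (c x z) * pdiff U x z) has_sum laplacian c U x) UNIV"
    unfolding laplacian_pdiff using laplacian_summable[OF assms] by (rule has_sum_infsum)
  from has_sum_add[OF has_sum_row[OF this] has_sum_column[OF this]]
  have "((\<lambda>p. (case p of (y, z) \<Rightarrow> if y = x then complex_of_real (c x z) * pdiff U x z else 0)
            + (case p of (y, z) \<Rightarrow> if z = x then complex_of_real (c x y) * pdiff U x y else 0))
         has_sum (laplacian c U x + laplacian c U x)) UNIV" .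
  also have "(\<lambda>p. (case p of (y, z) \<Rightarrow> if y = x then complex_of_real (c x z) * pdiff U x z else 0)
            + (case p of (y, z) \<Rightarrow> if z = x then complex_of_real (c x y) * pdiff U x y else 0))
     = (\<lambda>(y, z). complex_of_real (c y z) * cnj (pdiff (potential_of (dirac x)) y z) * pdiff U y z)"
    by (auto simp: dirac_def fun_eq_iff no_loops symmetric[of x] pdiff_swap[of U x])
  finally show ?thesis unfolding energy_pdiff by (simp add: infsumI)
qed

abbreviation "diracs \<equiv> range (\<lambda>x. potential_of (dirac x))"

lemma Harm_iff: "U \<in> Harm c \<longleftrightarrow> U \<in> H \<and> (\<forall>x. energy c (potential_of (dirac x)) U = 0)"
  by (auto simp: Harm_def energy_dirac)

lemma Harm_in_H: "U \<in> Harm c \<Longrightarrow> U \<in> H"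
  by (simp add: Harm_iff)

lemma Harm_zero [simp]: "0 \<in> Harm c"
  by (simp add: Harm_iff)

lemma Harm_add: "U \<in> Harm c \<Longrightarrow> V \<in> Harm c \<Longrightarrow> U + V \<in> Harm c"
  by (simp add: Harm_iff energy_add_right)

lemma Harm_cscale: "U \<in> Harm c \<Longrightarrow> cscale a U \<in> Harm c"
  by (simp add: Harm_iff energy_cscale_right)

lemma Harm_pRe: assumes "U \<in> Harm c" shows "pRe U \<in> Harm c"
proof -
  have "laplacian c (pRe U) x = complex_of_real (Re (laplacian c U x))" for x
  proof -
    have "complex_of_real (c x y) * pdiff (pRe U) x y
        = complex_of_real (Re (complex_of_real (c x y) * pdiff U x y))" for y
      by simp
    then show ?thesis
      unfolding laplacian_pdiff
      by (simp only: infsum_complex_of_real infsum_Re[OF laplacian_summable[OF Harm_in_H[OF assms]]])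
  qed
  with assms show ?thesis by (simp add: Harm_def)
qed

lemma Harm_pIm: assumes "U \<in> Harm c" shows "pIm U \<in> Harm c"
proof -
  have "laplacian c (pIm U) x = complex_of_real (Im (laplacian c U x))" for x
  proof -
    have "complex_of_real (c x y) * pdiff (pIm U) x y
        = complex_of_real (Im (complex_of_real (c x y) * pdiff U x y))" for y
      by simp
    then show ?thesis
      unfolding laplacian_pdiff
      by (simp only: infsum_complex_of_real infsum_Im[OF laplacian_summable[OF Harm_in_H[OF assms]]])
  qed
  with assms show ?thesis by (simp add: Harm_def)
qed

lemma subspace_H: "potential.subspace H"
  by (simp add: potential.subspace_def)

lemma span_diracs_subset_H: "potential.span diracs \<subseteq> H"
  by (rule potential.span_minimal[OF _ subspace_H]) auto

lemma span_diracs_in_H: "U \<in> potential.span diracs \<Longrightarrow> U \<in> H"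
  using span_diracs_subset_H by blast

text \<open>Induction on the support: removing one point subtracts a multiple of a Dirac mass.\<close>
lemma finite_support_in_span:
  assumes "finite {x. \<phi> x \<noteq> 0}"
  shows "potential_of \<phi> \<in> potential.span diracs"
proof -
  have "{x. \<phi> x \<noteq> 0} \<subseteq> F \<Longrightarrow> potential_of \<phi> \<in> potential.span diracs" if "finite F" for F \<phi>
    using that
  proof (induction F arbitrary: \<phi> rule: finite_induct)
    case empty
    then have "potential_of \<phi> = 0" by (simp add: potential_eq_iff)
    then show ?case by (simp add: potential.span_zero)
  next
    case (insert x F)
    have "potential_of \<phi> = potential_of (\<phi>(x := 0)) + cscale (\<phi> x) (potential_of (dirac x))"
      by (auto simp: potential_eq_iff dirac_def)
    moreover have "potential_of (\<phi>(x := 0)) \<in> potential.span diracs"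
      using insert by (intro insert.IH) auto
    ultimately show ?case
      by (simp add: potential.span_add potential.span_scale potential.span_base)
  qed
  with assms show ?thesis by blast
qed

lemma energy_span_diracs_Harm:
  assumes "Z \<in> Harm c" "U \<in> potential.span diracs"
  shows "energy c U Z = 0"
proof -
  have "potential.subspace {U \<in> H. energy c U Z = 0}"
    using Harm_in_H[OF assms(1)] by (simp add: potential.subspace_def energy_add_left energy_cscale_left)
  moreover have "diracs \<subseteq> {U \<in> H. energy c U Z = 0}"
    using assms(1) by (auto simp: Harm_iff)
  ultimately have "potential.span diracs \<subseteq> {U \<in> H. energy c U Z = 0}"
    by (intro potential.span_minimal)
  with assms(2) show ?thesis by blast
qed

lemma energy_tendsto_0:
  assumes "\<And>n. X n \<in> H" "Z \<in> H" "(\<lambda>n. energy_norm c (X n)) \<longlonglongrightarrow> 0"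
  shows "(\<lambda>n. energy c (X n) Z) \<longlonglongrightarrow> 0"
proof (rule Lim_null_comparison)
  show "\<forall>\<^sub>F n in sequentially. norm (energy c (X n) Z) \<le> energy_norm c (X n) * energy_norm c Z"
    using energy_cauchy_schwarz assms by simp
  show "(\<lambda>n. energy_norm c (X n) * energy_norm c Z) \<longlonglongrightarrow> 0"
    by (rule tendsto_mult_left_zero) (rule assms(3))
qed

text \<open>The energy form is continuous in its first argument, by the Cauchy-Schwarz inequality.\<close>
lemma energy_closure_orthogonal:
  assumes "A \<subseteq> H" "\<And>V. V \<in> A \<Longrightarrow> energy c V Z = 0" "Z \<in> H" "U \<in> energy_closure c A"
  shows "energy c U Z = 0"
proof -
  have U: "U \<in> H" using assms(4) by (simp add: energy_closure_def)
  have "\<forall>n. \<exists>V\<in>A. energy_norm c (U - V) < 1 / real (Suc n)"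
    using assms(4) unfolding energy_closure_def by simp
  then obtain X where X: "\<And>n. X n \<in> A" "\<And>n. energy_norm c (U - X n) < 1 / real (Suc n)" by metis
  have XH: "X n \<in> H" for n using X(1) assms(1) by blast
  have "(\<lambda>n. energy_norm c (U - X n)) \<longlonglongrightarrow> 0"
    by (rule tendsto_sandwich[OF _ _ tendsto_const LIMSEQ_Suc[OF lim_1_over_n]])
      (use less_imp_le[OF X(2)] in auto)
  then have "(\<lambda>n. energy c (U - X n) Z) \<longlonglongrightarrow> 0"
    by (intro energy_tendsto_0) (simp_all add: U XH assms(3))
  moreover have "energy c (U - X n) Z = energy c U Z" for n
    using U XH X(1) assms(2,3) by (simp add: energy_diff_left)
  ultimately show ?thesis by (simp add: LIMSEQ_const_iff)
qed

lemma energy_Fin_Harm: "U \<in> Fin c \<Longrightarrow> Z \<in> Harm c \<Longrightarrow> energy c U Z = 0"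
  unfolding Fin_def
  by (rule energy_closure_orthogonal) (auto simp: span_diracs_in_H energy_span_diracs_Harm Harm_in_H)

end


section \<open>Completeness and the Riesz representation theorem\<close>

context resistance_network
begin

text \<open>Point differences of a Cauchy sequence converge by \<open>pdiff_bound\<close>; the limits of the differences to a base point
  define the limit \<open>W\<close>.  That \<open>X n - W\<close> has small energy follows by letting \<open>m\<close> tend to infinity in
  finite partial sums of the energy of \<open>X n - X m\<close>.\<close>
lemma energy_space_complete:
  assumes XH: "\<And>n. X n \<in> H"
    and cauchy: "\<And>e. e > 0 \<Longrightarrow> \<exists>N. \<forall>m\<ge>N. \<forall>n\<ge>N. energy_norm c (X m - X n) < e"
  shows "\<exists>W\<in>H. (\<lambda>n. energy_norm c (X n - W)) \<longlonglongrightarrow> 0"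
proof -
  have conv: "convergent (\<lambda>n. pdiff (X n) x y)" for x y
  proof -
    obtain C where C: "C \<ge> 0" "\<And>U. U \<in> H \<Longrightarrow> cmod (pdiff U x y) \<le> C * energy_norm c U"
      using pdiff_bound by blast
    have "Cauchy (\<lambda>n. pdiff (X n) x y)"
    proof (rule CauchyI)
      fix e :: real assume "e > 0"
      then have "e / (C + 1) > 0" using C(1) by simp
      then obtain N where N: "\<forall>m\<ge>N. \<forall>n\<ge>N. energy_norm c (X m - X n) < e / (C + 1)"
        using cauchy by blast
      have "norm (pdiff (X m) x y - pdiff (X n) x y) < e" if "m \<ge> N" "n \<ge> N" for m n
      proof -
        have "norm (pdiff (X m) x y - pdiff (X n) x y) \<le> C * energy_norm c (X m - X n)"
          using C(2)[of "X m - X n"] XH by simp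
        also have "\<dots> \<le> (C + 1) * energy_norm c (X m - X n)"
          by (rule mult_right_mono) simp_all
        also have "\<dots> < (C + 1) * (e / (C + 1))"
          using N that C(1) by (intro mult_strict_left_mono) auto
        finally show ?thesis using C(1) by simp
      qed
      then show "\<exists>M. \<forall>m\<ge>M. \<forall>n\<ge>M. norm (pdiff (X m) x y - pdiff (X n) x y) < e" by blast
    qed
    then show ?thesis by (simp add: Cauchy_convergent_iff)
  qed
  define w where "w x = lim (\<lambda>n. pdiff (X n) x undefined)" for x
  define W where "W = potential_of w"
  have lim: "(\<lambda>n. pdiff (X n) x y) \<longlonglongrightarrow> pdiff W x y" for x y
  proof -
    have *: "(\<lambda>n. pdiff (X n) x undefined) \<longlonglongrightarrow> w x" for x
      unfolding w_def using conv[of x undefined] by (rule convergent_LIMSEQ_iff[THEN iffD1])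
    have "pdiff (X n) x undefined - pdiff (X n) y undefined = pdiff (X n) x y" for n
      using pdiff_triangle[of "X n" x undefined y] by simp
    with tendsto_diff[OF *[of x] *[of y]] show ?thesis by (simp add: W_def)
  qed
  have main: "X n - W \<in> H \<and> (energy_norm c (X n - W))\<^sup>2 \<le> e\<^sup>2"
    if N: "\<forall>m\<ge>N. \<forall>n\<ge>N. energy_norm c (X m - X n) < e" and "n \<ge> N" for n N e
  proof -
    let ?f = "\<lambda>U. \<lambda>(x, y). c x y * (cmod (pdiff U x y))\<^sup>2"
    have fin: "sum (?f (X n - W)) F \<le> 2 * e\<^sup>2" if "finite F" for F
    proof (rule LIMSEQ_le_const2)
      show "(\<lambda>m. sum (?f (X n - X m)) F) \<longlonglongrightarrow> sum (?f (X n - W)) F"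
        by (auto simp: case_prod_unfold intro!: tendsto_intros lim)
      have "sum (?f (X n - X m)) F \<le> 2 * e\<^sup>2" if "m \<ge> N" for m
      proof -
        have "X n - X m \<in> H" using XH by simp
        then have "sum (?f (X n - X m)) F \<le> infsum (?f (X n - X m)) UNIV"
          unfolding in_energy_space_iff
          by (rule finite_sum_le_infsum) (use \<open>finite F\<close> nonneg in auto)
        also have "\<dots> = 2 * (energy_norm c (X n - X m))\<^sup>2" by (simp add: energy_norm_sq)
        also have "\<dots> \<le> 2 * e\<^sup>2"
          using N \<open>n \<ge> N\<close> that by (intro mult_left_mono power_mono) (auto intro: less_imp_le)
        finally show ?thesis .
      qed
      then show "\<exists>N. \<forall>m\<ge>N. sum (?f (X n - X m)) F \<le> 2 * e\<^sup>2" by blast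
    qed
    have H: "?f (X n - W) summable_on UNIV"
    proof (rule nonneg_bdd_above_summable_on)
      show "bdd_above (sum (?f (X n - W)) ` {F. F \<subseteq> UNIV \<and> finite F})"
        by (rule bdd_aboveI[of _ "2 * e\<^sup>2"]) (use fin in auto)
    qed (auto simp: nonneg)
    have "infsum (?f (X n - W)) UNIV \<le> 2 * e\<^sup>2"
      by (rule infsum_le_finite_sums[OF H]) (use fin in auto)
    with H show ?thesis unfolding in_energy_space_iff energy_norm_sq by simp
  qed
  obtain N where "\<forall>m\<ge>N. \<forall>n\<ge>N. energy_norm c (X m - X n) < 1"
    using cauchy[OF zero_less_one] by blast
  \<comment> \<open>\<open>W\<close> has finite energy because \<open>X N\<close> and \<open>X N - W\<close> have.\<close>
  from main[OF this, of N] have "X N - W \<in> H" by simp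
  from diff_in_H[OF XH[of N] this] have "X N - (X N - W) \<in> H" .
  moreover have "X N - (X N - W) = W" by simp
  ultimately have "W \<in> H" by (simp only:)
  moreover have "(\<lambda>n. energy_norm c (X n - W)) \<longlonglongrightarrow> 0"
  proof (rule LIMSEQ_I)
    fix r :: real assume "r > 0"
    from cauchy[OF half_gt_zero[OF this]]
    obtain N where N: "\<forall>m\<ge>N. \<forall>n\<ge>N. energy_norm c (X m - X n) < r / 2" by (rule exE)
    have "norm (energy_norm c (X n - W) - 0) < r" if "n \<ge> N" for n
    proof -
      have "energy_norm c (X n - W) \<le> r / 2"
        by (rule power2_le_imp_le) (use main[OF N that] \<open>r > 0\<close> in auto)
      with \<open>r > 0\<close> show ?thesis by simp
    qed
    then show "\<exists>N. \<forall>n\<ge>N. norm (energy_norm c (X n - W) - 0) < r" by blast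
  qed
  ultimately show ?thesis by blast
qed

text \<open>The representative minimizes \<open>J U = \<parallel>U\<parallel>\<^sup>2 - 2 Re (L U)\<close>.  A minimizing sequence in \<open>S\<close> is Cauchy by the
  parallelogram law, and the first variation of \<open>J\<close> vanishes at its limit.  The subspace \<open>S\<close> may be
  incomplete; the limit then lies in its closure.  This is what makes the lemma applicable to
  functionals given on the span of the Dirac masses only.\<close>
lemma riesz_representation:
  assumes S: "potential.subspace S" "S \<subseteq> H"
    and L_add: "\<And>U V. U \<in> S \<Longrightarrow> V \<in> S \<Longrightarrow> L (U + V) = L U + L V"
    and L_scale: "\<And>a U. U \<in> S \<Longrightarrow> L (cscale a U) = a * L U"
    and L_bound: "\<And>U. U \<in> S \<Longrightarrow> cmod (L U) \<le> M * energy_norm c U"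
  shows "\<exists>W\<in>energy_closure c S. \<forall>U\<in>S. energy c W U = L U"
proof -
  define J where "J U = (energy_norm c U)\<^sup>2 - 2 * Re (L U)" for U
  define m where "m = Inf (J ` S)"
  have SH: "U \<in> S \<Longrightarrow> U \<in> H" for U using S(2) by blast
  have S0: "0 \<in> S" and S_add: "\<And>U V. U \<in> S \<Longrightarrow> V \<in> S \<Longrightarrow> U + V \<in> S"
    and S_scale: "\<And>a U. U \<in> S \<Longrightarrow> cscale a U \<in> S"
    using S(1) by (auto simp: potential.subspace_def)
  have "- M\<^sup>2 \<le> J U" if "U \<in> S" for U
  proof -
    have "Re (L U) \<le> M * energy_norm c U"
      using L_bound[OF that] complex_Re_le_cmod[of "L U"] by linarith
    moreover have "0 \<le> (energy_norm c U - M)\<^sup>2" by simp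
    ultimately show ?thesis unfolding J_def power2_diff by (simp add: mult_ac)
  qed
  then have bdd: "bdd_below (J ` S)" by (intro bdd_belowI[of _ "- M\<^sup>2"]) auto
  have m_le: "m \<le> J U" if "U \<in> S" for U
    unfolding m_def using bdd that by (intro cInf_lower) auto
  have "\<exists>U\<in>S. J U < m + 1 / real (Suc n)" for n
    using cInf_lessD[of "J ` S" "m + 1 / real (Suc n)"] S0 unfolding m_def by auto
  then obtain X where X: "\<And>n. X n \<in> S" "\<And>n. J (X n) < m + 1 / real (Suc n)" by metis
  have XH: "X n \<in> H" for n using X(1) SH by blast
  \<comment> \<open>Compare the two values of \<open>J\<close> with the value at the midpoint, which is at least \<open>m\<close>.\<close>
  have close: "(energy_norm c (X n - X k))\<^sup>2 \<le> 2 / real (Suc n) + 2 / real (Suc k)" for n k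
  proof -
    let ?U = "X n" and ?V = "X k"
    have "m \<le> J (cscale (1 / 2) (?U + ?V))" by (intro m_le S_scale S_add X)
    also have "\<dots> = (energy_norm c (?U + ?V))\<^sup>2 / 4 - Re (L ?U) - Re (L ?V)"
      by (simp add: J_def energy_norm_cscale power_mult_distrib L_scale S_add X L_add power2_eq_square add_divide_distrib)
    finally have "4 * m + 4 * Re (L ?U) + 4 * Re (L ?V) \<le> (energy_norm c (?U + ?V))\<^sup>2" by simp
    moreover have "(energy_norm c (?U - ?V))\<^sup>2 + (energy_norm c (?U + ?V))\<^sup>2
        = 2 * (energy_norm c ?U)\<^sup>2 + 2 * (energy_norm c ?V)\<^sup>2"
      by (simp add: energy_norm_add_sq energy_norm_diff_sq XH)
    ultimately have "(energy_norm c (?U - ?V))\<^sup>2 \<le> 2 * (J ?U - m) + 2 * (J ?V - m)"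
      by (simp add: J_def)
    with X(2)[of n] X(2)[of k] show ?thesis by simp
  qed
  have "\<exists>N. \<forall>n\<ge>N. \<forall>k\<ge>N. energy_norm c (X n - X k) < e" if "e > 0" for e
  proof -
    obtain N where N: "inverse (real (Suc N)) < e\<^sup>2 / 4" using reals_Archimedean[of "e\<^sup>2 / 4"] \<open>e > 0\<close> by auto
    have "energy_norm c (X n - X k) < e" if "n \<ge> N" "k \<ge> N" for n k
    proof (rule power_less_imp_less_base)
      have "2 / real (Suc n) \<le> 2 / real (Suc N)" "2 / real (Suc k) \<le> 2 / real (Suc N)"
        using that by (simp_all add: frac_le)
      with close[of n k] N show "(energy_norm c (X n - X k))\<^sup>2 < e\<^sup>2" by (simp add: inverse_eq_divide)
    qed (use \<open>e > 0\<close> in simp)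
    then show ?thesis by blast
  qed
  from energy_space_complete[OF XH this]
  obtain W where W: "W \<in> H" "(\<lambda>n. energy_norm c (X n - W)) \<longlonglongrightarrow> 0" by blast
  have "W \<in> energy_closure c S"
    unfolding energy_closure_def
  proof (clarsimp simp: W(1))
    fix e :: real assume "e > 0"
    from LIMSEQ_D[OF W(2) this] obtain n where "energy_norm c (X n - W) < e" by auto
    then show "\<exists>V\<in>S. energy_norm c (W - V) < e"
      using X(1) by (subst energy_norm_minus_commute) blast
  qed
  moreover have Re_eq: "Re (energy c W Z) = Re (L Z)" if "Z \<in> S" for Z
  proof -
    define d where "d = Re (energy c W Z) - Re (L Z)"
    define a where "a = (energy_norm c Z)\<^sup>2"
    have ZH: "Z \<in> H" using that by (rule SH)
    have "(\<lambda>n. energy c (X n - W) Z) \<longlonglongrightarrow> 0"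
      by (rule energy_tendsto_0) (simp_all add: XH W ZH)
    then have "(\<lambda>n. energy c (X n - W) Z + energy c W Z) \<longlonglongrightarrow> 0 + energy c W Z"
      by (intro tendsto_add tendsto_const)
    then have lim: "(\<lambda>n. energy c (X n) Z) \<longlonglongrightarrow> energy c W Z"
      by (simp add: energy_diff_left XH W ZH)
    \<comment> \<open>The limit of \<open>J (X n) - 1 / (n + 1) < m \<le> J (X n + t Z)\<close>.\<close>
    have quad: "0 \<le> 2 * t * d + t\<^sup>2 * a" for t :: real
    proof (rule LIMSEQ_le_const)
      show "(\<lambda>n. 1 / real (Suc n) + (2 * t * (Re (energy c (X n) Z) - Re (L Z)) + t\<^sup>2 * a))
          \<longlonglongrightarrow> 2 * t * d + t\<^sup>2 * a"
        unfolding d_def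
        using tendsto_add[OF LIMSEQ_Suc[OF lim_1_over_n] tendsto_add[OF tendsto_mult[OF tendsto_const
              tendsto_diff[OF tendsto_Re[OF lim] tendsto_const]] tendsto_const]]
        by simp
      have "0 \<le> 1 / real (Suc n) + (2 * t * (Re (energy c (X n) Z) - Re (L Z)) + t\<^sup>2 * a)" for n
      proof -
        have "m \<le> J (X n + cscale (of_real t) Z)" by (intro m_le S_add S_scale X that)
        also have "\<dots> = J (X n) + (2 * t * (Re (energy c (X n) Z) - Re (L Z)) + t\<^sup>2 * a)"
          by (simp add: J_def a_def energy_norm_add_sq XH ZH energy_cscale_right energy_norm_cscale
              L_add L_scale S_scale X that power_mult_distrib algebra_simps)
        finally show ?thesis using X(2)[of n] by simp
      qed
      then show "\<exists>N. \<forall>n\<ge>N. 0 \<le> 1 / real (Suc n) + (2 * t * (Re (energy c (X n) Z) - Re (L Z)) + t\<^sup>2 * a)"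
        by blast
    qed
    have a: "a \<ge> 0" by (simp add: a_def)
    \<comment> \<open>A step against the slope \<open>d\<close>; the denominator \<open>a + 1\<close> also covers \<open>a = 0\<close>.\<close>
    have "0 \<le> 2 * (- d / (a + 1)) * d + (- d / (a + 1))\<^sup>2 * a" by (rule quad)
    also have "\<dots> = - d\<^sup>2 * (a + 2) / (a + 1)\<^sup>2"
      using a by (simp add: divide_simps) (simp add: power2_eq_square algebra_simps)
    finally have "d\<^sup>2 * (a + 2) / (a + 1)\<^sup>2 \<le> 0" by simp
    then have "d\<^sup>2 * (a + 2) \<le> 0" using a by (simp add: divide_le_0_iff)
    then have "d = 0" using a by (simp add: mult_le_0_iff)
    then show ?thesis by (simp add: d_def)
  qed
  moreover have "energy c W Z = L Z" if "Z \<in> S" for Z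
    using Re_eq[OF that] Re_eq[OF S_scale[OF that, of \<i>]]
    by (simp add: complex_eq_iff energy_cscale_right L_scale that)
  ultimately show ?thesis by blast
qed

end


section \<open>The energy kernel and its harmonic part\<close>

context resistance_network
begin

text \<open>Point differences are bounded functionals, so the Riesz theorem gives existence; uniqueness, which
  the definite description in the definition needs, holds because the energy form is definite.\<close>
lemma energy_kernel_reproducing:
  shows "energy_kernel c b x \<in> H" and "U \<in> H \<Longrightarrow> energy c (energy_kernel c b x) U = pdiff U x b"
proof -
  obtain C where C: "\<And>U. U \<in> H \<Longrightarrow> cmod (pdiff U x b) \<le> C * energy_norm c U"
    using pdiff_bound by blast
  have "\<exists>V\<in>energy_closure c H. \<forall>U\<in>H. energy c V U = pdiff U x b"
    by (rule riesz_representation[where M = C]) (auto simp: subspace_H C)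
  then obtain V where V: "V \<in> H" "\<And>U. U \<in> H \<Longrightarrow> energy c V U = pdiff U x b"
    unfolding energy_closure_def by blast
  have "\<exists>!V. V \<in> H \<and> (\<forall>U\<in>H. energy c V U = pdiff U x b)"
  proof (rule ex1I[of _ V])
    fix V' assume V': "V' \<in> H \<and> (\<forall>U\<in>H. energy c V' U = pdiff U x b)"
    then have "energy c (V' - V) (V' - V) = 0"
      using V by (subst energy_diff_left) simp_all
    then have "V' - V = 0" using V' V(1) by (intro energy_self_eq_0) simp_all
    then show "V' = V" by simp
  qed (use V in auto)
  from theI'[OF this]
  show "energy_kernel c b x \<in> H" "U \<in> H \<Longrightarrow> energy c (energy_kernel c b x) U = pdiff U x b"
    unfolding energy_kernel_def by auto
qed

lemma energy_proj_eqI: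
  assumes "K \<subseteq> H" "W \<in> K" "U \<in> H" "\<And>Z. Z \<in> K \<Longrightarrow> energy c Z (U - W) = 0"
  shows "energy_proj c K U = W"
  unfolding energy_proj_def
proof (rule the_equality)
  fix W' assume W': "W' \<in> K \<and> (\<forall>Z\<in>K. energy c Z (U - W') = 0)"
  have H: "W \<in> H" "W' \<in> H" using assms W' by auto
  have "energy c Z (W' - W) = 0" if "Z \<in> K" for Z
  proof -
    have "Z \<in> H" using that assms(1) by blast
    with H assms(3) have "energy c Z (W' - W) = energy c Z (U - W) - energy c Z (U - W')"
      by (simp add: energy_diff_right)
    with assms(4)[OF that] W' that show ?thesis by simp
  qed
  then have "energy c (W' - W) (W' - W) = 0"
    using H W' assms(2) by (subst energy_diff_left) simp_all
  then have "W' - W = 0" using H by (intro energy_self_eq_0) simp_all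
  then show "W' = W" by simp
qed (use assms in auto)

text \<open>Represent \<open>Z \<mapsto> \<langle>U, Z\<rangle>\<close> on the span of the Dirac masses by some \<open>W\<close> in \<open>Fin\<close>.  Then \<open>U - W\<close> is orthogonal
  to every Dirac mass, which by Green's formula means that it is harmonic.  So every element of the
  energy space is the sum of an element of \<open>Fin\<close> and a harmonic one.\<close>
lemma energy_proj_Fin:
  assumes "U \<in> H"
  shows "energy_proj c (Fin c) U \<in> Fin c" and "U - energy_proj c (Fin c) U \<in> Harm c"
proof -
  have "\<exists>W\<in>energy_closure c (potential.span diracs). \<forall>Z\<in>potential.span diracs. energy c W Z = energy c U Z"
  proof (rule riesz_representation)
    show "cmod (energy c U Z) \<le> energy_norm c U * energy_norm c Z" if "Z \<in> potential.span diracs" for Z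
      using assms span_diracs_in_H[OF that] by (rule energy_cauchy_schwarz)
  qed (use assms in \<open>auto simp: potential.subspace_span span_diracs_in_H energy_add_right energy_cscale_right\<close>)
  then obtain W where W: "W \<in> Fin c" "\<And>Z. Z \<in> potential.span diracs \<Longrightarrow> energy c W Z = energy c U Z"
    unfolding Fin_def by blast
  have WH: "W \<in> H" using W(1) by (simp add: Fin_def energy_closure_def)
  have "energy c (potential_of (dirac x)) (U - W) = 0" for x
  proof -
    have "energy c W (potential_of (dirac x)) = energy c U (potential_of (dirac x))"
      by (intro W potential.span_base) simp
    from arg_cong[OF this, of cnj] show ?thesis
      by (simp add: energy_diff_right assms WH flip: energy_cnj)
  qed
  then have harm: "U - W \<in> Harm c" using assms WH by (simp add: Harm_iff)
  have "energy_proj c (Fin c) U = W"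
    by (rule energy_proj_eqI)
      (use W(1) assms harm in \<open>auto simp: energy_Fin_Harm Fin_def energy_closure_def\<close>)
  with W(1) harm show "energy_proj c (Fin c) U \<in> Fin c" "U - energy_proj c (Fin c) U \<in> Harm c" by auto
qed

lemma Fin_in_H: "U \<in> Fin c \<Longrightarrow> U \<in> H"
  by (simp add: Fin_def energy_closure_def)

text \<open>The decomposition of the energy space into \<open>Fin\<close> and \<open>Harm\<close>, applied to the energy kernel; it also
  shows that the projection to \<open>Harm\<close> in the definition of \<open>harm_kernel\<close> exists.\<close>
lemma harm_kernel_eq: "harm_kernel c b x = energy_kernel c b x - fin_kernel c b x"
  unfolding harm_kernel_def fin_kernel_def
proof (rule energy_proj_eqI)
  fix Z assume Z: "Z \<in> Harm c"
  have "energy c (energy_proj c (Fin c) (energy_kernel c b x)) Z = 0"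
    by (intro energy_Fin_Harm energy_proj_Fin energy_kernel_reproducing Z)
  then show "energy c Z (energy_kernel c b x - (energy_kernel c b x - energy_proj c (Fin c) (energy_kernel c b x))) = 0"
    by (subst energy_cnj) simp
qed (auto simp: energy_kernel_reproducing energy_proj_Fin Harm_in_H)

lemma harm_kernel_in_Harm: "harm_kernel c b x \<in> Harm c"
  unfolding harm_kernel_eq fin_kernel_def by (intro energy_proj_Fin energy_kernel_reproducing)

lemma energy_harm_kernel:
  assumes "U \<in> Harm c"
  shows "energy c (harm_kernel c b x) U = pdiff U x b"
proof -
  have "fin_kernel c b x \<in> Fin c"
    unfolding fin_kernel_def by (intro energy_proj_Fin energy_kernel_reproducing)
  with assms show ?thesis
    unfolding harm_kernel_eq
    by (simp add: energy_diff_left energy_kernel_reproducing energy_Fin_Harm Fin_in_H Harm_in_H)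
qed

text \<open>Let \<open>h = p + \<i> q\<close> with \<open>p\<close> and \<open>q\<close> real-valued.  The reproducing property at the harmonic element \<open>q\<close> says
  that \<open>\<langle>h, q\<rangle>\<close> is real; but the imaginary part of \<open>\<langle>q, h\<rangle> = \<langle>q, p\<rangle> + \<i> \<langle>q, q\<rangle>\<close> is \<open>\<parallel>q\<parallel>\<^sup>2\<close>,
  as \<open>\<langle>q, p\<rangle>\<close> is real.\<close>
lemma harm_kernel_real: "pIm (harm_kernel c b x) = 0"
proof (rule energy_self_eq_0)
  let ?h = "harm_kernel c b x" let ?a = "pRe ?h" and ?b = "pIm ?h"
  have H: "?h \<in> H" "?a \<in> H" "?b \<in> H" by (simp_all add: harm_kernel_in_Harm Harm_in_H)
  show "?b \<in> H" by fact
  have cnj_real: "cnj (energy c (pIm ?h) (pRe V)) = energy c (pIm ?h) (pRe V)" for V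
    unfolding energy_pdiff by (simp add: case_prod_unfold flip: infsum_cnj)
  have "energy c ?h ?b = complex_of_real (Im (pdiff ?h x b))"
    by (simp add: energy_harm_kernel Harm_pIm harm_kernel_in_Harm)
  then have 1: "Im (energy c ?b ?h) = 0" by (subst energy_cnj) simp
  have "energy c ?b ?h = energy c ?b ?a + \<i> * energy c ?b ?b"
    using H by (subst (2) pRe_plus_i_pIm) (simp add: energy_add_right energy_cscale_right)
  moreover have "Im (energy c ?b ?a) = 0" using cnj_real[of ?h] by (metis Reals_cnj_iff complex_is_Real_iff)
  ultimately have "Re (energy c ?b ?b) = 0" using 1 by simp
  then show "energy c ?b ?b = 0" by (simp add: energy_self_norm)
qed

end


section \<open>Networks without monopoles\<close>

context resistance_network
begin

text \<open>A monopole at \<open>b\<close> is the same as a Riesz representative of the evaluation \<open>\<phi> \<mapsto> \<phi> b\<close> on finitely supported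
  functions, because pairing with the Dirac mass at \<open>x\<close> gives the Laplacian at \<open>x\<close>.  Evaluation is not a
  priori a function of the class of \<open>\<phi>\<close> modulo constants; it becomes one by the bound, as two finitely
  supported functions in the same class differ by a function of energy 0, which vanishes at \<open>b\<close>.\<close>
lemma monopole_if_evaluation_bounded:
  assumes bound: "\<And>\<phi>. finite {x. \<phi> x \<noteq> 0} \<Longrightarrow> cmod (\<phi> b) \<le> M * energy_norm c (potential_of \<phi>)"
  shows "\<exists>W. monopole c b W"
proof -
  define fs where "fs = {\<phi> :: 'v \<Rightarrow> complex. finite {x. \<phi> x \<noteq> 0}}"
  define S where "S = potential_of ` fs"
  define L where "L U = (SOME \<phi>. \<phi> \<in> fs \<and> potential_of \<phi> = U) b" for U
  have fs_0: "(\<lambda>_. 0) \<in> fs" by (simp add: fs_def)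
  have fs_add: "(\<lambda>x. \<phi> x + \<psi> x) \<in> fs" if "\<phi> \<in> fs" "\<psi> \<in> fs" for \<phi> \<psi>
    using that unfolding fs_def
    by (auto intro: finite_subset[of _ "{x. \<phi> x \<noteq> 0} \<union> {x. \<psi> x \<noteq> 0}"])
  have fs_scale: "(\<lambda>x. a * \<phi> x) \<in> fs" if "\<phi> \<in> fs" for a \<phi>
    using that unfolding fs_def by (auto intro: finite_subset[of _ "{x. \<phi> x \<noteq> 0}"])
  have of_add: "potential_of (\<lambda>x. \<phi> x + \<psi> x) = potential_of \<phi> + potential_of \<psi>" for \<phi> \<psi> :: "'v \<Rightarrow> complex"
    by (simp add: potential_eq_iff)
  have of_scale: "potential_of (\<lambda>x. a * \<phi> x) = cscale a (potential_of \<phi>)" for a and \<phi> :: "'v \<Rightarrow> complex"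
    by (simp add: potential_eq_iff algebra_simps)
  have L: "L (potential_of \<phi>) = \<phi> b" if "\<phi> \<in> fs" for \<phi>
  proof -
    define \<psi> where "\<psi> = (SOME \<psi>. \<psi> \<in> fs \<and> potential_of \<psi> = potential_of \<phi>)"
    have \<psi>: "\<psi> \<in> fs \<and> potential_of \<psi> = potential_of \<phi>"
      unfolding \<psi>_def by (rule someI[of _ \<phi>]) (simp add: that)
    have "(\<lambda>x. \<psi> x + (-1) * \<phi> x) \<in> fs" by (intro fs_add fs_scale that conjunct1[OF \<psi>])
    moreover have "potential_of (\<lambda>x. \<psi> x + (-1) * \<phi> x) = 0"
      unfolding of_add of_scale using \<psi> by simp
    ultimately have "cmod (\<psi> b + (-1) * \<phi> b) \<le> 0"
      using bound[of "\<lambda>x. \<psi> x + (-1) * \<phi> x"] by (simp add: fs_def)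
    then show ?thesis by (simp add: L_def flip: \<psi>_def)
  qed
  have "\<exists>W\<in>energy_closure c S. \<forall>U\<in>S. energy c W U = L U"
  proof (rule riesz_representation[where M = M])
    show "potential.subspace S"
      unfolding potential.subspace_def S_def
    proof (intro conjI ballI allI; (elim imageE)?; clarify?)
      have "0 = potential_of (\<lambda>_ :: 'v. 0)" by (simp add: potential_eq_iff)
      with fs_0 show "0 \<in> potential_of ` fs" by blast
      show "potential_of \<phi> + potential_of \<psi> \<in> potential_of ` fs" if "\<phi> \<in> fs" "\<psi> \<in> fs" for \<phi> \<psi>
        unfolding of_add[symmetric] using fs_add[OF that] by (rule imageI)
      show "cscale a (potential_of \<phi>) \<in> potential_of ` fs" if "\<phi> \<in> fs" for a \<phi>
        unfolding of_scale[symmetric] using fs_scale[OF that] by (rule imageI)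
    qed
    show "S \<subseteq> H"
      unfolding S_def fs_def using finite_support_in_span span_diracs_in_H by blast
    show "L (U + V) = L U + L V" if "U \<in> S" "V \<in> S" for U V
    proof -
      obtain \<phi> \<psi> where "\<phi> \<in> fs" "U = potential_of \<phi>" "\<psi> \<in> fs" "V = potential_of \<psi>"
        using \<open>U \<in> S\<close> \<open>V \<in> S\<close> unfolding S_def by blast
      then show ?thesis using L[OF fs_add[of \<phi> \<psi>]] by (simp add: L of_add)
    qed
    show "L (cscale a U) = a * L U" if "U \<in> S" for a U
    proof -
      obtain \<phi> where "\<phi> \<in> fs" "U = potential_of \<phi>" using \<open>U \<in> S\<close> unfolding S_def by blast
      then show ?thesis using L[OF fs_scale[of \<phi> a]] by (simp add: L of_scale)
    qed
    show "cmod (L U) \<le> M * energy_norm c U" if "U \<in> S" for U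
    proof -
      obtain \<phi> where "\<phi> \<in> fs" "U = potential_of \<phi>" using \<open>U \<in> S\<close> unfolding S_def by blast
      then show ?thesis using bound[of \<phi>] by (simp add: L) (simp add: fs_def)
    qed
  qed
  then obtain W where W: "W \<in> H" "\<And>\<phi>. \<phi> \<in> fs \<Longrightarrow> energy c W (potential_of \<phi>) = \<phi> b"
    unfolding energy_closure_def S_def using L by auto
  have "laplacian c W x = dirac b x" for x
  proof -
    have "dirac x \<in> fs" by (simp add: fs_def dirac_def)
    then have "energy c (potential_of (dirac x)) W = cnj (dirac x b)"
      using W(2) by (subst energy_cnj) simp
    then show ?thesis using energy_dirac[OF W(1), of x] by (simp add: dirac_def)
  qed
  with W(1) show ?thesis unfolding monopole_def by blast
qed

text \<open>Without a monopole at \<open>b\<close>, evaluation at \<open>b\<close> is unbounded, so for each \<open>n\<close> some finitely supported \<open>\<phi>\<^sub>n\<close> has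
  \<open>(n + 1) * \<parallel>\<phi>\<^sub>n\<parallel> < \<bar>\<phi>\<^sub>n b\<bar>\<close>.  Taking absolute values does not increase the energy, and dividing by
  \<open>\<bar>\<phi>\<^sub>n b\<bar>\<close> normalizes the value at \<open>b\<close>.\<close>
lemma recurrent_cutoffs:
  assumes "\<nexists>W. monopole c b W"
  obtains \<psi> :: "nat \<Rightarrow> 'v \<Rightarrow> real"
  where "\<And>n. finite {x. \<psi> n x \<noteq> 0}" "\<And>n x. 0 \<le> \<psi> n x" "\<And>n. \<psi> n b = 1"
    "\<And>n. energy_norm c (potential_of (\<lambda>x. complex_of_real (\<psi> n x))) \<le> 1 / real (Suc n)"
proof -
  have "\<exists>\<phi>. finite {x. \<phi> x \<noteq> 0} \<and> real (Suc n) * energy_norm c (potential_of \<phi>) < cmod (\<phi> b)" for n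
    using monopole_if_evaluation_bounded[of b "real (Suc n)"] assms by (meson not_le)
  then obtain \<phi> :: "nat \<Rightarrow> 'v \<Rightarrow> complex" where \<phi>: "\<And>n. finite {x. \<phi> n x \<noteq> 0}"
      "\<And>n. real (Suc n) * energy_norm c (potential_of (\<phi> n)) < cmod (\<phi> n b)"
    by metis
  have pos: "0 < cmod (\<phi> n b)" for n
    by (rule le_less_trans[OF mult_nonneg_nonneg \<phi>(2)[of n]]) simp_all
  define \<psi> where "\<psi> n x = cmod (\<phi> n x) / cmod (\<phi> n b)" for n x
  have norm: "energy_norm c (potential_of (\<lambda>x. complex_of_real (\<psi> n x))) \<le> 1 / real (Suc n)" for n
  proof -
    let ?a = "complex_of_real (1 / cmod (\<phi> n b))"
    have "energy_norm c (potential_of (\<lambda>x. complex_of_real (\<psi> n x)))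
        \<le> energy_norm c (cscale ?a (potential_of (\<phi> n)))"
    proof (rule energy_norm_mono)
      show "cscale ?a (potential_of (\<phi> n)) \<in> H"
        by (intro cscale_in_H span_diracs_in_H finite_support_in_span \<phi>)
      fix x y
      have "pdiff (potential_of (\<lambda>x. complex_of_real (\<psi> n x))) x y
          = complex_of_real ((cmod (\<phi> n x) - cmod (\<phi> n y)) / cmod (\<phi> n b))"
        by (simp add: \<psi>_def diff_divide_distrib)
      then have "cmod (pdiff (potential_of (\<lambda>x. complex_of_real (\<psi> n x))) x y)
          = \<bar>cmod (\<phi> n x) - cmod (\<phi> n y)\<bar> / cmod (\<phi> n b)"
        by (simp only: norm_of_real abs_divide abs_norm_cancel)
      also have "\<dots> \<le> cmod (\<phi> n x - \<phi> n y) / cmod (\<phi> n b)"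
        by (intro divide_right_mono norm_triangle_ineq3) simp
      finally show "cmod (pdiff (potential_of (\<lambda>x. complex_of_real (\<psi> n x))) x y)
          \<le> cmod (pdiff (cscale ?a (potential_of (\<phi> n))) x y)"
        by (simp add: norm_mult norm_divide)
    qed
    also have "\<dots> = energy_norm c (potential_of (\<phi> n)) / cmod (\<phi> n b)"
      unfolding energy_norm_cscale norm_of_real by simp
    also have "\<dots> \<le> 1 / real (Suc n)"
      using \<phi>(2)[of n] pos[of n] by (simp add: field_simps del: of_nat_Suc)
    finally show ?thesis .
  qed
  show thesis
    by (rule that[of \<psi>]) (use norm \<phi>(1) pos in \<open>auto simp: \<psi>_def less_imp_neq[symmetric]\<close>)
qed

text \<open>Test \<open>r\<close> against the finitely supported \<open>s \<psi>\<^sub>n\<close>, where \<open>s\<close> is \<open>r\<close> truncated to \<open>[-k, k]\<close>.  By harmonicity the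
  sum of \<open>T (x, y) = c x y * (s x * \<psi>\<^sub>n x - s y * \<psi>\<^sub>n y) * (r x - r y)\<close> over all pairs is 0.  By the product
  rule \<open>T\<close> is \<open>A (x, y) = c x y * \<psi>\<^sub>n x * (s x - s y) * (r x - r y)\<close> plus a term containing the difference of
  \<open>\<psi>\<^sub>n\<close>, whose sum is \<open>O(1 / n)\<close> because \<open>s\<close> is bounded.  All values of \<open>A\<close> are nonnegative, since \<open>s\<close> is
  a monotone function of \<open>r\<close>; so each of them is \<open>O(1 / n)\<close>, and \<open>\<psi>\<^sub>n p \<longlonglongrightarrow> 1\<close> leaves
  \<open>c p q * (s p - s q) * (r p - r q) \<le> 0\<close>.\<close>
lemma Harm_real_trivial_if_no_monopole:
  assumes no: "\<nexists>W. monopole c b W"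
    and harm: "potential_of (\<lambda>x. complex_of_real (r x)) \<in> Harm c"
  shows "potential_of (\<lambda>x. complex_of_real (r x)) = 0"
proof -
  let ?h = "potential_of (\<lambda>x. complex_of_real (r x))"
  have hH: "?h \<in> H" using harm by (rule Harm_in_H)
  obtain \<psi> where \<psi>: "\<And>n. finite {x. \<psi> n x \<noteq> 0}" "\<And>n x. 0 \<le> \<psi> n x" "\<And>n. \<psi> n b = 1"
    and small: "\<And>n. energy_norm c (potential_of (\<lambda>x. complex_of_real (\<psi> n x))) \<le> 1 / real (Suc n)"
    using recurrent_cutoffs[OF no] by metis
  let ?\<psi> = "\<lambda>n. potential_of (\<lambda>x. complex_of_real (\<psi> n x))"
  have \<psi>H: "?\<psi> n \<in> H" for n
    using \<psi>(1)[of n] by (intro span_diracs_in_H finite_support_in_span) simp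
  have \<psi>_lim: "(\<lambda>n. \<psi> n x) \<longlonglongrightarrow> 1" for x
  proof -
    obtain C where C: "C \<ge> 0" "\<And>U. U \<in> H \<Longrightarrow> cmod (pdiff U x b) \<le> C * energy_norm c U"
      using pdiff_bound by blast
    have "norm (\<psi> n x - 1) \<le> C * (1 / real (Suc n))" for n
    proof -
      have "norm (\<psi> n x - 1) = cmod (pdiff (?\<psi> n) x b)"
        using norm_of_real[of "\<psi> n x - 1", where 'a = complex] by (simp add: \<psi>(3))
      also have "\<dots> \<le> C * energy_norm c (?\<psi> n)" by (intro C \<psi>H)
      also have "\<dots> \<le> C * (1 / real (Suc n))" by (intro mult_left_mono small C(1))
      finally show ?thesis .
    qed
    then have "(\<lambda>n. \<psi> n x - 1) \<longlonglongrightarrow> 0"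
      by (intro Lim_null_comparison[OF always_eventually tendsto_mult_right_zero[OF
            LIMSEQ_Suc[OF lim_1_over_n]]] allI)
    then show ?thesis by (rule LIM_zero_cancel)
  qed
  have edge: "r p = r q" if "c p q > 0" for p q
  proof -
    \<comment> \<open>Large enough for the truncation to leave \<open>r p\<close> and \<open>r q\<close> unchanged.\<close>
    define k where "k = \<bar>r p\<bar> + \<bar>r q\<bar>"
    define s where "s x = max (- k) (min k (r x))" for x
    define E where "E = (energy_norm c ?h)\<^sup>2"
    have sp: "s p = r p" "s q = r q" and k: "k \<ge> 0"
      by (auto simp: s_def k_def)
    have sk: "\<bar>s x\<bar> \<le> k" for x
      using k by (auto simp: s_def)
    have mono: "0 \<le> (s x - s y) * (r x - r y)" for x y
    proof (cases "r x \<le> r y")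
      case True
      then have "s x \<le> s y" by (auto simp: s_def)
      with True show ?thesis by (simp add: mult_nonpos_nonpos)
    next
      case False
      then have "s y \<le> s x" by (auto simp: s_def)
      with False show ?thesis by simp
    qed
    have step: "c p q * (\<psi> n p * ((s p - s q) * (r p - r q))) \<le> k * (1 + E) * (1 / real (Suc n))" for n
    proof -
      let ?N = "real (Suc n)"
      define A where "A = (\<lambda>(x, y). c x y * (\<psi> n x * ((s x - s y) * (r x - r y))))"
      define T where "T = (\<lambda>(x, y). c x y * ((s x * \<psi> n x - s y * \<psi> n y) * (r x - r y)))"
      \<comment> \<open>\<open>G\<close> dominates the term with the difference of \<open>\<psi> n\<close>, by the weighted AM-GM inequality \<open>amgm\<close>.
          The weight \<open>?N\<close> balances \<open>\<parallel>\<psi> n\<parallel>\<^sup>2 \<le> 1 / ?N\<^sup>2\<close> against the fixed energy of \<open>r\<close>.\<close>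
      define G where "G = (\<lambda>(x, y). k / 2 * (?N * (c x y * (\<psi> n x - \<psi> n y)\<^sup>2) + (1 / ?N) * (c x y * (r x - r y)\<^sup>2)))"
      let ?\<eta> = "potential_of (\<lambda>x. complex_of_real (s x * \<psi> n x))"
      have \<eta>: "?\<eta> \<in> potential.span diracs"
        using \<psi>(1)[of n] by (intro finite_support_in_span) (auto intro: finite_subset[of _ "{x. \<psi> n x \<noteq> 0}"])
      have T_eq: "complex_of_real (T p) = (case p of (x, y) \<Rightarrow>
          complex_of_real (c x y) * cnj (pdiff ?\<eta> x y) * pdiff ?h x y)" for p
        by (auto simp: T_def split: prod.split)
      have T_sum: "T summable_on UNIV"
        using summable_on_Re[OF edge_product_summable[OF span_diracs_in_H[OF \<eta>] hH]]
        unfolding T_eq[symmetric] Re_complex_of_real .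
      have "complex_of_real (infsum T UNIV) = 2 * energy c ?\<eta> ?h"
        unfolding energy_pdiff T_eq[symmetric] infsum_complex_of_real[symmetric] by simp
      then have T_0: "infsum T UNIV = 0"
        using energy_span_diracs_Harm[OF harm \<eta>] by simp
      have sq: "(cmod (complex_of_real a - complex_of_real b))\<^sup>2 = (a - b)\<^sup>2" for a b
        by (simp flip: of_real_diff)
      have S\<psi>: "(\<lambda>(x, y). c x y * (\<psi> n x - \<psi> n y)\<^sup>2) summable_on UNIV"
        using \<psi>H[of n] unfolding in_energy_space_iff by (simp add: sq)
      have Sh: "(\<lambda>(x, y). c x y * (r x - r y)\<^sup>2) summable_on UNIV"
        using hH unfolding in_energy_space_iff by (simp add: sq)
      have I\<psi>: "(\<Sum>\<^sub>\<infinity>(x, y). c x y * (\<psi> n x - \<psi> n y)\<^sup>2) = 2 * (energy_norm c (?\<psi> n))\<^sup>2"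
        unfolding energy_norm_sq by (simp add: sq)
      have Ih: "(\<Sum>\<^sub>\<infinity>(x, y). c x y * (r x - r y)\<^sup>2) = 2 * E"
        unfolding E_def energy_norm_sq by (simp add: sq)
      have "((\<lambda>p. k / 2 * (?N * (case p of (x, y) \<Rightarrow> c x y * (\<psi> n x - \<psi> n y)\<^sup>2)
              + (1 / ?N) * (case p of (x, y) \<Rightarrow> c x y * (r x - r y)\<^sup>2)))
          has_sum k / 2 * (?N * (2 * (energy_norm c (?\<psi> n))\<^sup>2) + (1 / ?N) * (2 * E))) UNIV"
        unfolding I\<psi>[symmetric] Ih[symmetric]
        by (intro has_sum_cmult_right has_sum_add has_sum_infsum S\<psi> Sh)
      also have "(\<lambda>p. k / 2 * (?N * (case p of (x, y) \<Rightarrow> c x y * (\<psi> n x - \<psi> n y)\<^sup>2)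
              + (1 / ?N) * (case p of (x, y) \<Rightarrow> c x y * (r x - r y)\<^sup>2))) = G"
        unfolding G_def by (auto simp: fun_eq_iff)
      finally have G_sum: "(G has_sum k / 2 * (?N * (2 * (energy_norm c (?\<psi> n))\<^sup>2) + (1 / ?N) * (2 * E))) UNIV" .
      have A_le: "A e \<le> T e + G e" for e
      proof -
        obtain x y where e: "e = (x, y)" by fastforce
        let ?d = "\<bar>\<psi> n x - \<psi> n y\<bar>" and ?g = "\<bar>r x - r y\<bar>"
        have amgm: "?d * ?g \<le> 1 / 2 * (?N * (\<psi> n x - \<psi> n y)\<^sup>2 + (1 / ?N) * (r x - r y)\<^sup>2)"
        proof -
          have "0 \<le> (?N * ?d - ?g)\<^sup>2 / ?N" by simp
          also have "\<dots> = ?N * ?d\<^sup>2 + (1 / ?N) * ?g\<^sup>2 - 2 * (?d * ?g)"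
            by (simp add: power2_eq_square field_simps del: of_nat_Suc)
          finally show ?thesis by (simp del: of_nat_Suc)
        qed
        have "A e - T e = c x y * (- s y * (\<psi> n x - \<psi> n y) * (r x - r y))"
          by (simp add: A_def T_def e algebra_simps)
        also have "\<dots> \<le> c x y * (k * (?d * ?g))"
        proof (rule mult_left_mono[OF _ nonneg])
          have "- s y * (\<psi> n x - \<psi> n y) * (r x - r y) \<le> \<bar>- s y * (\<psi> n x - \<psi> n y) * (r x - r y)\<bar>"
            by (rule abs_ge_self)
          also have "\<dots> = \<bar>s y\<bar> * (?d * ?g)" by (simp add: abs_mult)
          also have "\<dots> \<le> k * (?d * ?g)" by (intro mult_right_mono sk) simp
          finally show "- s y * (\<psi> n x - \<psi> n y) * (r x - r y) \<le> k * (?d * ?g)" .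
        qed
        also have "\<dots> \<le> c x y * (k * (1 / 2 * (?N * (\<psi> n x - \<psi> n y)\<^sup>2 + (1 / ?N) * (r x - r y)\<^sup>2)))"
          by (intro mult_left_mono amgm nonneg k)
        also have "\<dots> = G e" by (simp add: G_def e algebra_simps del: of_nat_Suc)
        finally show ?thesis by simp
      qed
      have A_nonneg: "0 \<le> A e" for e
        by (cases e) (auto simp: A_def intro!: mult_nonneg_nonneg nonneg \<psi> mono)
      have TG: "((\<lambda>e. T e + G e) has_sum
          0 + k / 2 * (?N * (2 * (energy_norm c (?\<psi> n))\<^sup>2) + (1 / ?N) * (2 * E))) UNIV"
        using has_sum_infsum[OF T_sum] unfolding T_0 by (intro has_sum_add G_sum)
      have "A (p, q) \<le> sum (\<lambda>e. T e + G e) {(p, q)}" using A_le by simp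
      also have "\<dots> \<le> 0 + k / 2 * (?N * (2 * (energy_norm c (?\<psi> n))\<^sup>2) + (1 / ?N) * (2 * E))"
        by (rule finite_sum_le_has_sum[OF TG]) (use order_trans[OF A_nonneg A_le] in auto)
      also have "\<dots> \<le> 0 + k / 2 * (?N * (2 * (1 / ?N)\<^sup>2) + (1 / ?N) * (2 * E))"
        by (intro add_left_mono mult_left_mono add_right_mono power_mono small) (use k in auto)
      also have "\<dots> = k * (1 + E) * (1 / ?N)"
        by (simp add: power2_eq_square field_simps del: of_nat_Suc)
      finally show ?thesis by (simp add: A_def)
    qed
    have "c p q * (1 * ((s p - s q) * (r p - r q))) \<le> 0"
    proof (rule LIMSEQ_le)
      show "(\<lambda>n. c p q * (\<psi> n p * ((s p - s q) * (r p - r q)))) \<longlonglongrightarrow> c p q * (1 * ((s p - s q) * (r p - r q)))"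
        by (intro tendsto_intros \<psi>_lim)
      show "(\<lambda>n. k * (1 + E) * (1 / real (Suc n))) \<longlonglongrightarrow> 0"
        by (intro tendsto_mult_right_zero LIMSEQ_Suc[OF lim_1_over_n])
    qed (use step in blast)
    then have "(r p - r q)\<^sup>2 \<le> 0"
      using \<open>c p q > 0\<close> by (simp add: sp power2_eq_square mult_le_0_iff)
    then show ?thesis by simp
  qed
  have "r x = r y" for x y
    using connected[of x y] by (induction rule: rtranclp_induct) (auto dest: edge)
  then show ?thesis by (simp add: potential_eq_iff)
qed

lemma Harm_trivial_if_no_monopole:
  assumes "\<nexists>W. monopole c b W" "U \<in> Harm c"
  shows "U = 0"
proof -
  have "pRe U = 0"
    using Harm_pRe[OF assms(2)] real_valued_pRe[of U] Harm_real_trivial_if_no_monopole[OF assms(1)]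
    unfolding real_valued_def by metis
  moreover have "pIm U = 0"
    using Harm_pIm[OF assms(2)] real_valued_pIm[of U] Harm_real_trivial_if_no_monopole[OF assms(1)]
    unfolding real_valued_def by metis
  ultimately show ?thesis using pRe_plus_i_pIm[of U] by simp
qed

end


section \<open>Self-adjoint extensions vanish on harmonic elements\<close>

context resistance_network
begin

text \<open>The two shifted kernels in the domain are \<open>v\<^sub>x + w\<close> and \<open>f\<^sub>x + w\<close>; their difference is \<open>h\<^sub>x\<close>.\<close>
lemma harm_kernel_in_M_domain:
  assumes "monopole c y W"
  shows "harm_kernel c b x \<in> M_domain c b"
proof -
  let ?w = "min_monopole c b"
  let ?B = "range (\<lambda>x. energy_kernel c b x + ?w) \<union> range (\<lambda>x. fin_kernel c b x + ?w)"
  have "(energy_kernel c b x + ?w) - (fin_kernel c b x + ?w) \<in> potential.span ?B"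
    by (intro potential.span_diff potential.span_base) auto
  then have "harm_kernel c b x \<in> potential.span ?B" by (simp add: harm_kernel_eq)
  moreover have "0 \<in> potential.span (range (energy_kernel c b))" by (rule potential.span_zero)
  moreover have "harm_kernel c b x = 0 + harm_kernel c b x" by simp
  moreover have "\<exists>x W. monopole c x W" using assms by blast
  ultimately show ?thesis unfolding M_domain_def by (simp only: if_True) blast
qed

lemma harm_kernel_in_ker_Delta_M:
  assumes "monopole c y W"
  shows "(harm_kernel c b x, 0) \<in> Delta_M c b"
proof -
  have "potential_of (laplacian c (harm_kernel c b x)) = 0"
    using harm_kernel_in_Harm[of b x] by (simp add: Harm_def potential_eq_iff)
  then show ?thesis
    using harm_kernel_in_M_domain[OF assms, of b x] Harm_in_H[OF harm_kernel_in_Harm]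
    unfolding Delta_M_def by (auto intro!: bexI[of _ "harm_kernel c b x"])
qed

text \<open>By self-adjointness it suffices that every \<open>B\<close> in the range of \<open>T\<close> is orthogonal to \<open>Harm\<close>.  If there is a
  monopole, \<open>B\<close> is orthogonal to each \<open>h\<^sub>x\<close>, which lies in the kernel; this annihilates the harmonic
  component of \<open>B\<close>, by the reproducing property.\<close>
lemma Harm_in_ker_self_adjoint:
  assumes sa: "self_adjoint c T" and ext: "Delta_M c b \<subseteq> T" and U: "U \<in> Harm c"
  shows "(U, 0) \<in> T"
proof -
  have T: "T = adjoint_op c T" using sa by (simp add: self_adjoint_def)
  have "energy c U B = 0" if AB: "(A, B) \<in> T" for A B
  proof (cases "\<exists>W. monopole c b W")
    case False
    then show ?thesis using Harm_trivial_if_no_monopole[OF _ U] by simp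
  next
    case True
    then obtain W where W: "monopole c b W" by blast
    from AB T have "(A, B) \<in> adjoint_op c T" by blast
    then have B: "B \<in> H" and adj: "\<And>A' B'. (A', B') \<in> T \<Longrightarrow> energy c A B' = energy c B A'"
      unfolding adjoint_op_def by auto
    define f where "f = energy_proj c (Fin c) B"
    have f: "f \<in> Fin c" "B - f \<in> Harm c" unfolding f_def using energy_proj_Fin[OF B] by auto
    have "pdiff (B - f) x b = 0" for x
    proof -
      let ?h = "harm_kernel c b x"
      have h: "?h \<in> Harm c" by (rule harm_kernel_in_Harm)
      have "energy c B ?h = 0"
        using adj[OF subsetD[OF ext harm_kernel_in_ker_Delta_M[OF W]]] by simp
      moreover have "energy c f ?h = 0" using f(1) h by (rule energy_Fin_Harm)
      ultimately have "energy c (B - f) ?h = 0"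
        using B f(1) h by (simp add: energy_diff_left Fin_in_H Harm_in_H)
      then have "energy c ?h (B - f) = 0" by (subst energy_cnj) simp
      then show ?thesis unfolding energy_harm_kernel[OF f(2)] .
    qed
    then have "B - f = 0"
      using pdiff_triangle[of "B - f" _ _ b] pdiff_swap[of "B - f"]
      unfolding potential_eq_iff by (metis add.right_neutral neg_equal_0_iff_equal pdiff_zero)
    with f(1) have "energy c B U = 0" using energy_Fin_Harm[OF _ U] by simp
    then show ?thesis by (subst energy_cnj) simp
  qed
  then have "(U, 0) \<in> adjoint_op c T"
    unfolding adjoint_op_def using Harm_in_H[OF U] by auto
  with T show ?thesis by simp
qed

text \<open>An element annihilated by \<open>T\<close> is in the domain of all powers of \<open>T\<close>.\<close>
lemma real_Harm_in_test_space:
  assumes "self_adjoint c T" "Delta_M c b \<subseteq> T" "U \<in> Harm c" "real_valued U"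
  shows "U \<in> test_space T"
proof -
  have U: "(U, 0) \<in> T" and 0: "(0, 0) \<in> T"
    using Harm_in_ker_self_adjoint[OF assms(1,2)] assms(3) by auto
  have "(U, 0) \<in> T ^^ Suc n" for n
  proof (induction n)
    case (Suc n)
    then show ?case using 0 by (subst relpow.simps) blast
  qed (simp add: U)
  then have "U \<in> Domain (T ^^ p)" if "p \<ge> 1" for p
    using that by (cases p) (simp, blast)
  with assms(4) show ?thesis by (simp add: test_space_def)
qed

end

section \<open>Second moments of white noise\<close>

text \<open>By Levy's uniqueness theorem \<open>X\<close> has the distribution of \<open>\<sigma>\<close> times a standard normal variable.
  Scaling the variable instead of the density covers the degenerate case \<open>\<sigma> = 0\<close>.\<close>
lemma (in prob_space) second_moment_if_gaussian:
  assumes X: "X \<in> borel_measurable M"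
    and char: "\<And>t. (LINT x|M. exp (\<i> * complex_of_real (t * X x)))
      = complex_of_real (exp (- (1 / 2) * (t * \<sigma>)\<^sup>2))"
  shows "integrable M (\<lambda>x. (X x)\<^sup>2)" and "(LINT x|M. (X x)\<^sup>2) = \<sigma>\<^sup>2"
proof -
  interpret N: real_distribution std_normal_distribution by (rule real_dist_normal_dist)
  have eq: "distr M borel X = distr std_normal_distribution borel (\<lambda>x. \<sigma> * x)"
  proof (rule Levy_uniqueness)
    show "real_distribution (distr M borel X)" using X by (rule real_distribution_distr)
    show "real_distribution (distr std_normal_distribution borel (\<lambda>x. \<sigma> * x))"
      by (rule N.real_distribution_distr) simp
    show "char (distr M borel X) = char (distr std_normal_distribution borel (\<lambda>x. \<sigma> * x))"
    proof
      fix t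
      have "char (distr M borel X) t = complex_of_real (exp (- ((t * \<sigma>)\<^sup>2) / 2))"
        unfolding char_def using X char[of t] by (simp add: integral_distr)
      also have "\<dots> = char std_normal_distribution (t * \<sigma>)"
        unfolding char_std_normal_distribution ..
      also have "\<dots> = char (distr std_normal_distribution borel (\<lambda>x. \<sigma> * x)) t"
        unfolding char_def by (subst integral_distr) (simp_all add: mult_ac)
      finally show "char (distr M borel X) t = char (distr std_normal_distribution borel (\<lambda>x. \<sigma> * x)) t" .
    qed
  qed
  have "integrable std_normal_distribution (\<lambda>x. (\<sigma> * x)\<^sup>2)"
    using std_normal_distribution_even_moments(2)[of 1] by (simp add: power_mult_distrib)
  then have "integrable (distr std_normal_distribution borel (\<lambda>x. \<sigma> * x)) (\<lambda>x. x\<^sup>2)"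
    by (subst integrable_distr_eq) simp_all
  then show "integrable M (\<lambda>x. (X x)\<^sup>2)"
    unfolding eq[symmetric] using X by (subst (asm) integrable_distr_eq) simp_all
  have "(LINT x|M. (X x)\<^sup>2) = (LINT x|distr M borel X. x\<^sup>2)"
    using X by (simp add: integral_distr)
  also have "\<dots> = (LINT x|std_normal_distribution. \<sigma>\<^sup>2 * x\<^sup>2)"
    unfolding eq by (simp add: integral_distr power_mult_distrib)
  also have "\<dots> = \<sigma>\<^sup>2"
    using std_normal_distribution_even_moments(1)[of 1] by simp
  finally show "(LINT x|M. (X x)\<^sup>2) = \<sigma>\<^sup>2" .
qed

text \<open>Evaluation at a test function is continuous for the weak-* topology, and \<open>P\<close> is a Borel measure.\<close>
lemma eval_measurable:
  assumes "radon_probability (weak_star_topology c T) P" "s \<in> test_space T"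
  shows "(\<lambda>\<xi>. \<xi> s) \<in> borel_measurable P"
proof (rule borel_measurableI)
  let ?X = "weak_star_topology c T"
  fix A :: "real set" assume "open A"
  have space: "space P = topspace ?X" "sets P = sigma_sets (topspace ?X) {A. openin ?X A}"
    using assms(1) by (auto simp: radon_probability_def)
  have "continuous_map ?X euclideanreal (\<lambda>\<xi>. \<xi> s)"
    unfolding weak_star_topology_def
    by (intro continuous_map_from_subtopology continuous_map_product_projection assms(2))
  then have "openin ?X {\<xi> \<in> topspace ?X. \<xi> s \<in> A}"
    by (rule openin_continuous_map_preimage) (simp add: \<open>open A\<close>)
  moreover have "(\<lambda>\<xi>. \<xi> s) -` A \<inter> space P = {\<xi> \<in> topspace ?X. \<xi> s \<in> A}"
    using space(1) by auto
  ultimately show "(\<lambda>\<xi>. \<xi> s) -` A \<inter> space P \<in> sets P"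
    unfolding space(2) by (auto intro: sigma_sets.Basic)
qed

lemma space_radon_distributions:
  assumes "radon_probability (weak_star_topology c T) P" "\<xi> \<in> space P"
  shows "\<xi> \<in> distributions c T"
  using assms by (simp add: radon_probability_def weak_star_topology_def)

text \<open>The characteristic functional at \<open>a V\<close>, for real \<open>a\<close>, is the characteristic function of \<open>\<xi> \<mapsto> \<xi> V\<close> at \<open>a\<close>, so
  the second moment of this variable is \<open>\<parallel>V\<parallel>\<^sup>2\<close>; polarization gives the mixed moments.\<close>
lemma (in resistance_network) white_noise_covariance:
  assumes sa: "self_adjoint c T" and ext: "Delta_M c b \<subseteq> T"
    and radon: "radon_probability (weak_star_topology c T) P"
    and minlos: "\<And>s. s \<in> test_space T \<Longrightarrow>
      (LINT \<xi>|P. exp (\<i> * complex_of_real (\<xi> s))) = complex_of_real (exp (- (1 / 2) * (energy_norm c s)\<^sup>2))"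
    and s: "s \<in> Harm c" "real_valued s" and t: "t \<in> Harm c" "real_valued t"
  shows "integrable P (\<lambda>\<xi>. \<xi> s * \<xi> t)" and "(LINT \<xi>|P. \<xi> s * \<xi> t) = Re (energy c s t)"
proof -
  interpret prob_space P using radon by (simp add: radon_probability_def)
  have real_scale: "real_valued (cscale (complex_of_real a) V)" if "real_valued V" for a V
  proof -
    obtain v where v: "V = potential_of (\<lambda>x. complex_of_real (v x))" using \<open>real_valued V\<close> real_valued_def by blast
    then have "cscale (complex_of_real a) V = potential_of (\<lambda>x. complex_of_real (a * v x))"
      unfolding v by (simp add: potential_eq_iff algebra_simps)
    then show ?thesis unfolding real_valued_def by (rule exI[of _ "\<lambda>x. a * v x"])
  qed
  have real_add: "real_valued (s + t)"
  proof -
    obtain u v where "s = potential_of (\<lambda>x. complex_of_real (u x))" "t = potential_of (\<lambda>x. complex_of_real (v x))"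
      using s(2) t(2) real_valued_def by metis
    then have "s + t = potential_of (\<lambda>x. complex_of_real (u x + v x))"
      by (simp add: potential_eq_iff)
    then show ?thesis unfolding real_valued_def by (rule exI[of _ "\<lambda>x. u x + v x"])
  qed
  have test: "V \<in> test_space T" if "V \<in> Harm c" "real_valued V" for V
    using that by (rule real_Harm_in_test_space[OF sa ext])
  have moment: "integrable P (\<lambda>\<xi>. (\<xi> V)\<^sup>2)" "(LINT \<xi>|P. (\<xi> V)\<^sup>2) = (energy_norm c V)\<^sup>2"
    if V: "V \<in> Harm c" "real_valued V" for V
  proof -
    have char: "(LINT \<xi>|P. exp (\<i> * complex_of_real (a * \<xi> V)))
        = complex_of_real (exp (- (1 / 2) * (a * energy_norm c V)\<^sup>2))" for a
    proof -
      have "(LINT \<xi>|P. exp (\<i> * complex_of_real (a * \<xi> V)))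
          = (LINT \<xi>|P. exp (\<i> * complex_of_real (\<xi> (cscale (complex_of_real a) V))))"
      proof (rule Bochner_Integration.integral_cong[OF refl])
        fix \<xi> assume "\<xi> \<in> space P"
        with space_radon_distributions[OF radon] test[OF V]
        have "\<xi> (cscale (complex_of_real a) V) = a * \<xi> V" by (auto simp: distributions_def)
        then show "exp (\<i> * complex_of_real (a * \<xi> V)) = exp (\<i> * complex_of_real (\<xi> (cscale (complex_of_real a) V)))"
          by simp
      qed
      also have "\<dots> = complex_of_real (exp (- (1 / 2) * (energy_norm c (cscale (complex_of_real a) V))\<^sup>2))"
        by (intro minlos test Harm_cscale real_scale V)
      also have "(energy_norm c (cscale (complex_of_real a) V))\<^sup>2 = (a * energy_norm c V)\<^sup>2"
        by (simp add: energy_norm_cscale power_mult_distrib)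
      finally show ?thesis .
    qed
    show "integrable P (\<lambda>\<xi>. (\<xi> V)\<^sup>2)" "(LINT \<xi>|P. (\<xi> V)\<^sup>2) = (energy_norm c V)\<^sup>2"
      using second_moment_if_gaussian[OF eval_measurable[OF radon test[OF V]] char] by auto
  qed
  have sum: "\<xi> s * \<xi> t = ((\<xi> (s + t))\<^sup>2 - (\<xi> s)\<^sup>2 - (\<xi> t)\<^sup>2) / 2" if "\<xi> \<in> space P" for \<xi>
  proof -
    have "\<xi> (s + t) = \<xi> s + \<xi> t"
      using space_radon_distributions[OF radon that] test[OF s] test[OF t] by (auto simp: distributions_def)
    then show ?thesis by (simp add: power2_sum)
  qed
  note st = Harm_add[OF s(1) t(1)] real_add
  have int: "integrable P (\<lambda>\<xi>. ((\<xi> (s + t))\<^sup>2 - (\<xi> s)\<^sup>2 - (\<xi> t)\<^sup>2) / 2)"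
    by (intro integrable_divide Bochner_Integration.integrable_diff moment(1) s t st)
  moreover have "integrable P (\<lambda>\<xi>. \<xi> s * \<xi> t)
      \<longleftrightarrow> integrable P (\<lambda>\<xi>. ((\<xi> (s + t))\<^sup>2 - (\<xi> s)\<^sup>2 - (\<xi> t)\<^sup>2) / 2)"
    by (rule Bochner_Integration.integrable_cong[OF refl sum])
  ultimately show "integrable P (\<lambda>\<xi>. \<xi> s * \<xi> t)" by (rule iffD2[rotated])
  have "(LINT \<xi>|P. \<xi> s * \<xi> t) = (LINT \<xi>|P. ((\<xi> (s + t))\<^sup>2 - (\<xi> s)\<^sup>2 - (\<xi> t)\<^sup>2) / 2)"
    by (rule Bochner_Integration.integral_cong[OF refl sum])
  also have "\<dots> = ((energy_norm c (s + t))\<^sup>2 - (energy_norm c s)\<^sup>2 - (energy_norm c t)\<^sup>2) / 2"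
    by (simp add: moment s t st)
  also have "\<dots> = Re (energy c s t)"
    using s t by (simp add: energy_norm_add_sq Harm_in_H)
  finally show "(LINT \<xi>|P. \<xi> s * \<xi> t) = Re (energy c s t)" .
qed

section \<open>The reproducing formula for harmonic functions\<close>

theorem corollary5p19:
  fixes c :: "'v \<Rightarrow> 'v \<Rightarrow> real" and b :: 'v
    and Delta_S :: "('v potential \<times> 'v potential) set"
    and P :: "('v potential \<Rightarrow> real) measure"
    and u :: "'v \<Rightarrow> complex"
  assumes network: "resistance_network c"
    and self_adjoint: "self_adjoint c Delta_S"
    and extension: "Delta_M c b \<subseteq> Delta_S"
    and radon: "radon_probability (weak_star_topology c Delta_S) P"
    and minlos: "\<And>s. s \<in> test_space Delta_S \<Longrightarrow>
      (LINT \<xi>|P. exp (\<i> * complex_of_real (real_pairing c Delta_S s \<xi>))) =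
        complex_of_real (exp (- (1 / 2) * (energy_norm c s)\<^sup>2))"
    and harmonic: "potential_of u \<in> Harm c"
  shows "\<forall>x. integrable P (\<lambda>\<xi>. pairing c Delta_S (potential_of u) \<xi> *
                               pairing c Delta_S (harm_kernel c b x) \<xi>) \<and>
    u x = (LINT \<xi>|P. pairing c Delta_S (potential_of u) \<xi> *
                     pairing c Delta_S (harm_kernel c b x) \<xi>) + u b"
proof
  fix x
  interpret resistance_network c by (rule network)
  let ?U = "potential_of u" and ?h = "harm_kernel c b x"
  let ?f = "\<lambda>\<xi>. pairing c Delta_S ?U \<xi> * pairing c Delta_S ?h \<xi>"
  have h: "?h \<in> Harm c" by (rule harm_kernel_in_Harm)
  have h_real: "pRe ?h = ?h"
    using pRe_plus_i_pIm[of ?h] harm_kernel_real[of b x] by simp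
  have test: "V \<in> test_space Delta_S" if "V \<in> Harm c" "real_valued V" for V
    using that by (rule real_Harm_in_test_space[OF self_adjoint extension])
  have tests: "pRe ?U \<in> test_space Delta_S" "pIm ?U \<in> test_space Delta_S"
    "pRe ?h \<in> test_space Delta_S" "pIm ?h \<in> test_space Delta_S"
    by (intro test Harm_pRe Harm_pIm harmonic h real_valued_pRe real_valued_pIm)+
  \<comment> \<open>All four pairings are evaluations at test functions, and the one with \<open>pIm ?h = 0\<close> vanishes.\<close>
  have f: "?f \<xi> = complex_of_real (\<xi> (pRe ?U) * \<xi> ?h) + \<i> * complex_of_real (\<xi> (pIm ?U) * \<xi> ?h)"
    if "\<xi> \<in> space P" for \<xi>
  proof -
    have "\<xi> (0 + 0) = \<xi> 0 + \<xi> 0"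
      using space_radon_distributions[OF radon that] tests(4)
      unfolding distributions_def harm_kernel_real by blast
    then have "\<xi> (pIm ?h) = 0" by (simp add: harm_kernel_real)
    with tests show ?thesis
      by (simp add: pairing_def real_pairing_def h_real algebra_simps)
  qed
  have minlos': "(LINT \<xi>|P. exp (\<i> * complex_of_real (\<xi> s))) = complex_of_real (exp (- (1 / 2) * (energy_norm c s)\<^sup>2))"
    if "s \<in> test_space Delta_S" for s
    using minlos[OF that] that by (simp add: real_pairing_def)
  have hr: "real_valued ?h" using real_valued_pRe[of ?h] by (simp add: h_real)
  have cov_int: "integrable P (\<lambda>\<xi>. \<xi> V * \<xi> ?h)" if "V \<in> Harm c" "real_valued V" for V
    by (rule white_noise_covariance(1)[OF self_adjoint extension radon minlos' that h hr])
  have cov: "(LINT \<xi>|P. \<xi> V * \<xi> ?h) = Re (energy c V ?h)" if "V \<in> Harm c" "real_valued V" for V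
    by (rule white_noise_covariance(2)[OF self_adjoint extension radon minlos' that h hr])
  have int: "integrable P (\<lambda>\<xi>. \<xi> (pRe ?U) * \<xi> ?h)" "integrable P (\<lambda>\<xi>. \<xi> (pIm ?U) * \<xi> ?h)"
    by (intro cov_int Harm_pRe Harm_pIm harmonic real_valued_pRe real_valued_pIm)+
  have val: "(LINT \<xi>|P. \<xi> (pRe ?U) * \<xi> ?h) = Re (pdiff ?U x b)"
    "(LINT \<xi>|P. \<xi> (pIm ?U) * \<xi> ?h) = Im (pdiff ?U x b)"
  proof -
    have "(LINT \<xi>|P. \<xi> V * \<xi> ?h) = Re (pdiff V x b)" if "V \<in> Harm c" "real_valued V" for V
    proof -
      have "(LINT \<xi>|P. \<xi> V * \<xi> ?h) = Re (energy c V ?h)"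
        by (rule cov[OF that])
      also have "\<dots> = Re (energy c ?h V)" by (subst energy_cnj) simp
      finally show ?thesis by (simp add: energy_harm_kernel that)
    qed
    from this[OF Harm_pRe[OF harmonic] real_valued_pRe] this[OF Harm_pIm[OF harmonic] real_valued_pIm]
    show "(LINT \<xi>|P. \<xi> (pRe ?U) * \<xi> ?h) = Re (pdiff ?U x b)"
      "(LINT \<xi>|P. \<xi> (pIm ?U) * \<xi> ?h) = Im (pdiff ?U x b)"
      by simp_all
  qed
  let ?g = "\<lambda>\<xi>. complex_of_real (\<xi> (pRe ?U) * \<xi> ?h) + \<i> * complex_of_real (\<xi> (pIm ?U) * \<xi> ?h)"
  have int_g: "integrable P (\<lambda>\<xi>. complex_of_real (\<xi> (pRe ?U) * \<xi> ?h))"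
    "integrable P (\<lambda>\<xi>. \<i> * complex_of_real (\<xi> (pIm ?U) * \<xi> ?h))"
    by (intro integrable_mult_right integrable_of_real int)+
  have "integrable P ?f \<longleftrightarrow> integrable P ?g"
    by (rule Bochner_Integration.integrable_cong[OF refl f])
  then have "integrable P ?f"
    using Bochner_Integration.integrable_add[OF int_g] by (rule iffD2)
  moreover have "(LINT \<xi>|P. ?f \<xi>) = pdiff ?U x b"
  proof -
    have "(LINT \<xi>|P. ?f \<xi>) = (LINT \<xi>|P. ?g \<xi>)"
      by (rule Bochner_Integration.integral_cong[OF refl f])
    also have "\<dots> = complex_of_real (Re (pdiff ?U x b)) + \<i> * complex_of_real (Im (pdiff ?U x b))"
      unfolding Bochner_Integration.integral_add[OF int_g] integral_mult_right_zero integral_complex_of_real val ..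
    also have "\<dots> = pdiff ?U x b" by (rule complex_eq[symmetric])
    finally show ?thesis .
  qed
  ultimately show "integrable P ?f \<and> u x = (LINT \<xi>|P. ?f \<xi>) + u b" by simp
qed

end
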